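(* Let $\Omega$ be a hyperbolic domain in $\mathbb{R}^n$, $n\ge3$, and let $f:\mathbb{D}^*\to\Omega$ be a conformal harmonic map. If there is a sequence $z_k\in\mathbb{D}^*$ converging to $0\in\mathbb{D}$ such that $f(z_k)$ converges to a point in $\Omega$, then $f$ extends to a conformal harmonic map $\mathbb{D}\to\Omega$.
   Context: A domain is a nonempty connected open set. $\mathbb{D}=\{z=x+iy\in\mathbb{C}:|z|<1\}$ and $\mathbb{D}^*=\mathbb{D}\setminus\{0\}$. A $C^1$ map $f$ from an open subset of $\mathbb{R}^2=\mathbb{C}$ to $\mathbb{R}^n$ is conformal if $|f_x|=|f_y|$ and $f_x\cdot f_y=0$ at every point (it need not be an immersion). $\mathrm{CH}(\mathbb{D},\Omega)$ denotes the set of all conformal harmonic maps $\mathbb{D}\to\Omega$. Minimal pseudometric: for $\mathbf{x}\in\Omega$, $\mathbf{v}\in\mathbb{R}^n$, $$g_\Omega(\mathbf{x},\mathbf{v})=\inf\{1/r>0:\exists f\in \mathrm{CH}(\mathbb{D},\Omega),\ f(0)=\mathbf{x},\ f_x(0)=r\mathbf{v}\}.$$ Minimal pseudodistance: $\rho_\Omega(\mathbf{x},\mathbf{y})=\inf_\gamma\int_0^1 g_\Omega(\gamma(t),\dot\gamma(t))\,dt$, the infimum over all piecewise smooth paths in $\Omega$ from $\mathbf{x}$ to $\mathbf{y}$. $\Omega$ is hyperbolic if $\rho_\Omega(\mathbf{x},\mathbf{y})>0$ for any pair of distinct points of $\Omega$. *)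

theory Defs
  imports "HOL-Analysis.Analysis"
begin

definition partial_x :: "(complex \<Rightarrow> 'a::real_normed_vector) \<Rightarrow> complex \<Rightarrow> 'a" where
  "partial_x f z = vector_derivative (\<lambda>t::real. f (z + of_real t)) (at 0)"

definition partial_y :: "(complex \<Rightarrow> 'a::real_normed_vector) \<Rightarrow> complex \<Rightarrow> 'a" where
  "partial_y f z = vector_derivative (\<lambda>t::real. f (z + \<i> * of_real t)) (at 0)"

text \<open>The next four predicates are meant for open \<^term>\<open>U\<close>; differentiability is that of a real map
  on the real plane, not complex differentiability.\<close>

definition C1_map_on :: "complex set \<Rightarrow> (complex \<Rightarrow> 'a::real_normed_vector) \<Rightarrow> bool" where
  "C1_map_on U f \<longleftrightarrow>
     (\<forall>z\<in>U. f differentiable (at z)) \<and> continuous_on U (partial_x f) \<and> continuous_on U (partial_y f)"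

definition C2_map_on :: "complex set \<Rightarrow> (complex \<Rightarrow> 'a::real_normed_vector) \<Rightarrow> bool" where
  "C2_map_on U f \<longleftrightarrow> C1_map_on U f \<and> C1_map_on U (partial_x f) \<and> C1_map_on U (partial_y f)"

definition harmonic_map_on :: "complex set \<Rightarrow> (complex \<Rightarrow> 'a::real_normed_vector) \<Rightarrow> bool" where
  "harmonic_map_on U f \<longleftrightarrow>
     C2_map_on U f \<and> (\<forall>z\<in>U. partial_x (partial_x f) z + partial_y (partial_y f) z = 0)"

definition conformal_map_on :: "complex set \<Rightarrow> (complex \<Rightarrow> 'a::real_inner) \<Rightarrow> bool" where
  "conformal_map_on U f \<longleftrightarrow>
     C1_map_on U f \<and>
     (\<forall>z\<in>U. norm (partial_x f z) = norm (partial_y f z) \<and> partial_x f z \<bullet> partial_y f z = 0)"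

text \<open>Maps are total functions; their values outside \<^term>\<open>U\<close> are irrelevant.\<close>

definition CH :: "complex set \<Rightarrow> 'a::real_inner set \<Rightarrow> (complex \<Rightarrow> 'a) set" where
  "CH U \<Omega> = {f. conformal_map_on U f \<and> harmonic_map_on U f \<and> f ` U \<subseteq> \<Omega>}"

abbreviation unit_disc :: "complex set" where
  "unit_disc \<equiv> ball 0 1"

text \<open>For open \<^term>\<open>\<Omega>\<close> in dimension at least two and \<^term>\<open>x \<in> \<Omega>\<close>, the set below is nonempty
  (small affine discs) and bounded below by 0, so the infimum is a genuine one.\<close>

definition minimal_pseudometric :: "'a::real_inner set \<Rightarrow> 'a \<Rightarrow> 'a \<Rightarrow> real" where
  "minimal_pseudometric \<Omega> x v =
     Inf {1 / r | r. 1 / r > 0 \<and> (\<exists>f \<in> CH unit_disc \<Omega>. f 0 = x \<and> partial_x f 0 = r *\<^sub>R v)}"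

text \<open>Smoothness on a closed interval, with one-sided derivatives at the end points:
  \<^term>\<open>D k\<close> is the derivative of order \<^term>\<open>k\<close>.\<close>

definition smooth_on_interval :: "real \<Rightarrow> real \<Rightarrow> (real \<Rightarrow> 'a::real_normed_vector) \<Rightarrow> bool" where
  "smooth_on_interval a b \<gamma> \<longleftrightarrow>
     (\<exists>D :: nat \<Rightarrow> real \<Rightarrow> 'a.
        (\<forall>t\<in>{a..b}. D 0 t = \<gamma> t) \<and>
        (\<forall>k. \<forall>t\<in>{a..b}. (D k has_vector_derivative D (Suc k) t) (at t within {a..b})))"

text \<open>Continuity at the partition points follows from smoothness on the closed pieces.\<close>

definition piecewise_smooth_path :: "(real \<Rightarrow> 'a::real_normed_vector) \<Rightarrow> bool" where
  "piecewise_smooth_path \<gamma> \<longleftrightarrow>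
     (\<exists>(m::nat) \<tau>. \<tau> 0 = 0 \<and> \<tau> m = 1 \<and>
        (\<forall>i<m. \<tau> i < \<tau> (Suc i) \<and> smooth_on_interval (\<tau> i) (\<tau> (Suc i)) \<gamma>))"

text \<open>The length integral of the nonnegative integrand is a Lebesgue integral with values in
  \<^typ>\<open>ennreal\<close>. The derivative of the path may be undefined at the finitely many partition
  points, which form a null set.\<close>

definition minimal_length :: "'a::real_inner set \<Rightarrow> (real \<Rightarrow> 'a) \<Rightarrow> ennreal" where
  "minimal_length \<Omega> \<gamma> =
     (\<integral>\<^sup>+t\<in>{0..1}. ennreal (minimal_pseudometric \<Omega> (\<gamma> t) (vector_derivative \<gamma> (at t))) \<partial>lborel)"

definition minimal_pseudodistance :: "'a::real_inner set \<Rightarrow> 'a \<Rightarrow> 'a \<Rightarrow> ennreal" where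
  "minimal_pseudodistance \<Omega> x y =
     Inf {minimal_length \<Omega> \<gamma> | \<gamma>. piecewise_smooth_path \<gamma> \<and> path_image \<gamma> \<subseteq> \<Omega> \<and>
            pathstart \<gamma> = x \<and> pathfinish \<gamma> = y}"

definition domain :: "'a::topological_space set \<Rightarrow> bool" where
  "domain \<Omega> \<longleftrightarrow> \<Omega> \<noteq> {} \<and> connected \<Omega> \<and> open \<Omega>"

definition hyperbolic :: "'a::real_inner set \<Rightarrow> bool" where
  "hyperbolic \<Omega> \<longleftrightarrow> (\<forall>x\<in>\<Omega>. \<forall>y\<in>\<Omega>. x \<noteq> y \<longrightarrow> minimal_pseudodistance \<Omega> x y > 0)"

end

theory Submission
  imports Defs "HOL-Complex_Analysis.Complex_Analysis"
begin

text \<open>The components of a conformal harmonic map have gradients \<open>\<phi>\<^sub>j = u\<^sub>x - \<i> u\<^sub>y\<close> that are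
  holomorphic with \<open>\<Sum>\<^sub>j \<phi>\<^sub>j\<^sup>2 = 0\<close>. Composing \<open>f\<close> with exponential discs shows that the image of
  the circle of radius \<open>r\<close> has length at most a constant times \<open>1 / log (1 / r)\<close> in the minimal
  metric. If the images of the circles through the \<open>z\<^sub>k\<close> did not shrink to \<open>p = lim f(z\<^sub>k)\<close>, they
  would cross a small sphere around \<open>p\<close> at points accumulating at some \<open>q \<noteq> p\<close>, and the
  pseudodistance of \<open>p\<close> and \<open>q\<close> would vanish. So they shrink, the maximum principle on the
  annuli between the circles gives \<open>f \<rightarrow> p\<close> at \<open>0\<close>, and the singularity is removable.\<close>

section \<open>Symmetry of second derivatives\<close>

text \<open>The mean value theorem in direction \<open>p\<close> turns the second difference into
  \<open>h\<close> times an increment of \<open>u' w p\<close> over the displacement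
  \<open>h *\<^sub>R q\<close>, and \<open>A\<close> is the linear part of such increments. The
  roles of \<open>p\<close> and \<open>q\<close> are deliberately unequal, so that exchanging them
  says something.\<close>

lemma second_difference_tendsto:
  fixes u :: "'a::real_normed_vector \<Rightarrow> real"
  assumes "open U" and "z \<in> U"
    and u: "\<And>w. w \<in> U \<Longrightarrow> (u has_derivative u' w) (at w)"
    and A: "((\<lambda>w. u' w p) has_derivative A) (at z)"
  shows "((\<lambda>h. (u (z + h *\<^sub>R p + h *\<^sub>R q) - u (z + h *\<^sub>R p) - u (z + h *\<^sub>R q) + u z) / h\<^sup>2)
           \<longlongrightarrow> A q) (at_right 0)"
proof (rule tendstoI)
  fix e :: real assume "e > 0"
  \<comment> \<open>Displacements \<open>s *\<^sub>R p + t *\<^sub>R q\<close> with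
    \<open>s\<close>, \<open>t\<close> between 0 and \<open>h\<close> have norm at most
    \<open>h * c\<close>; the summand 1 keeps \<open>c\<close> positive when
    \<open>p = q = 0\<close>.\<close>
  define c where "c = norm p + norm q + 1"
  have "c > 0" by (simp add: c_def add_nonneg_pos)
  define \<epsilon> where "\<epsilon> = e / (4 * c)"
  have "\<epsilon> > 0" using \<open>e > 0\<close> \<open>c > 0\<close> by (simp add: \<epsilon>_def)
  interpret A: bounded_linear A using A by (rule has_derivative_bounded_linear)
  obtain d1 where "d1 > 0" and d1: "\<And>w. norm (w - z) < d1 \<Longrightarrow>
      norm (u' w p - u' z p - A (w - z)) \<le> \<epsilon> * norm (w - z)"
    using A \<open>\<epsilon> > 0\<close> unfolding has_derivative_at_alt by blast
  obtain d2 where "d2 > 0" and d2: "ball z d2 \<subseteq> U"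
    using \<open>open U\<close> \<open>z \<in> U\<close> open_contains_ball by blast
  define d where "d = min d1 d2 / c"
  have "d > 0" using \<open>d1 > 0\<close> \<open>d2 > 0\<close> \<open>c > 0\<close> by (simp add: d_def)
  have "dist ((u (z + h *\<^sub>R p + h *\<^sub>R q) - u (z + h *\<^sub>R p) - u (z + h *\<^sub>R q) + u z) / h\<^sup>2) (A q) < e"
    if h: "0 < h" "h < d" for h
  proof -
    have hc: "h * c < min d1 d2" using h \<open>c > 0\<close> by (simp add: d_def pos_less_divide_eq)
    have small: "norm (s *\<^sub>R p + t *\<^sub>R q) \<le> h * c" if "0 \<le> s" "s \<le> h" "0 \<le> t" "t \<le> h" for s t
    proof -
      have "norm (s *\<^sub>R p + t *\<^sub>R q) \<le> s * norm p + t * norm q"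
        using norm_triangle_ineq[of "s *\<^sub>R p" "t *\<^sub>R q"] that by simp
      also have "\<dots> \<le> h * norm p + h * norm q"
        by (intro add_mono mult_right_mono) (use that in auto)
      also have "\<dots> \<le> h * c" using h by (simp add: c_def distrib_left)
      finally show ?thesis .
    qed
    have inU: "z + s *\<^sub>R p + t *\<^sub>R q \<in> U" if "0 \<le> s" "s \<le> h" "0 \<le> t" "t \<le> h" for s t
    proof -
      have "dist z (z + (s *\<^sub>R p + t *\<^sub>R q)) < d2"
        using small[OF that] hc by (subst dist_commute) (simp add: dist_norm)
      then show ?thesis using d2 by (auto simp: add.assoc)
    qed
    \<comment> \<open>The increment of \<open>g\<close> from 0 to \<open>h\<close> is the whole
      second difference.\<close>
    define g where "g s = u (z + s *\<^sub>R p + h *\<^sub>R q) - u (z + s *\<^sub>R p)" for s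
    have g': "(g has_real_derivative (u' (z + s *\<^sub>R p + h *\<^sub>R q) p - u' (z + s *\<^sub>R p) p)) (at s)"
      if "0 \<le> s" "s \<le> h" for s
    proof -
      have *: "((\<lambda>s. u (z + s *\<^sub>R p + t *\<^sub>R q)) has_real_derivative u' (z + s *\<^sub>R p + t *\<^sub>R q) p) (at s)"
        if "0 \<le> t" "t \<le> h" for t
      proof -
        let ?w = "z + s *\<^sub>R p + t *\<^sub>R q"
        have "(u has_derivative u' ?w) (at ?w)"
          using u inU \<open>0 \<le> s\<close> \<open>s \<le> h\<close> that by blast
        moreover have "((\<lambda>s. z + s *\<^sub>R p + t *\<^sub>R q) has_derivative (\<lambda>x. x *\<^sub>R p)) (at s)"
          by (auto intro!: derivative_eq_intros)
        ultimately have "((\<lambda>s. u (z + s *\<^sub>R p + t *\<^sub>R q)) has_derivative (\<lambda>x. u' ?w (x *\<^sub>R p))) (at s)"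
          using has_derivative_compose by blast
        moreover have "(\<lambda>x. u' ?w (x *\<^sub>R p)) = (*) (u' ?w p)"
          using linear_scale[OF has_derivative_linear[OF \<open>(u has_derivative u' ?w) (at ?w)\<close>]]
          by (simp add: fun_eq_iff)
        ultimately show ?thesis by (simp add: has_field_derivative_def)
      qed
      show ?thesis unfolding g_def
        using *[of h] *[of 0] h by (intro DERIV_diff) auto
    qed
    obtain s where s: "0 < s" "s < h"
      and gs: "g h - g 0 = (h - 0) * (u' (z + s *\<^sub>R p + h *\<^sub>R q) p - u' (z + s *\<^sub>R p) p)"
      using MVT2[OF h(1) g'] by blast
    define D where "D = u' (z + s *\<^sub>R p + h *\<^sub>R q) p - u' (z + s *\<^sub>R p) p"
    have e1: "norm (u' (z + s *\<^sub>R p + t *\<^sub>R q) p - u' z p - A (s *\<^sub>R p + t *\<^sub>R q)) \<le> \<epsilon> * (h * c)"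
      if "0 \<le> t" "t \<le> h" for t
    proof -
      have "norm (s *\<^sub>R p + t *\<^sub>R q) \<le> h * c" using small s that by simp
      then show ?thesis
        using order_trans[OF d1[of "z + (s *\<^sub>R p + t *\<^sub>R q)"] mult_left_mono[of _ _ \<epsilon>]] hc \<open>\<epsilon> > 0\<close>
        by (simp add: add.assoc)
    qed
    \<comment> \<open>The linear parts at \<open>t = h\<close> and \<open>t = 0\<close> differ by
      \<open>h * A q\<close>, and each contributes one error term.\<close>
    have "\<bar>D - h * A q\<bar> \<le> 2 * (\<epsilon> * (h * c))"
      using e1[of h] e1[of 0] h by (simp add: D_def A.add A.scaleR)
    also have "\<dots> = e / 2 * h" using \<open>c > 0\<close> by (simp add: \<epsilon>_def field_simps)
    finally have D: "\<bar>D - h * A q\<bar> \<le> e / 2 * h" .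
    have "u (z + h *\<^sub>R p + h *\<^sub>R q) - u (z + h *\<^sub>R p) - u (z + h *\<^sub>R q) + u z = h * D"
      using gs by (simp add: g_def D_def)
    then have "(u (z + h *\<^sub>R p + h *\<^sub>R q) - u (z + h *\<^sub>R p) - u (z + h *\<^sub>R q) + u z) / h\<^sup>2 - A q = (D - h * A q) / h"
      using h by (simp add: field_simps power2_eq_square)
    moreover have "\<bar>(D - h * A q) / h\<bar> \<le> e / 2"
      using D h by (simp add: abs_divide pos_divide_le_eq)
    ultimately show ?thesis using \<open>e > 0\<close> unfolding dist_real_def by linarith
  qed
  then show "\<forall>\<^sub>F h in at_right 0. dist ((u (z + h *\<^sub>R p + h *\<^sub>R q) - u (z + h *\<^sub>R p) - u (z + h *\<^sub>R q) + u z) / h\<^sup>2) (A q) < e"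
    using \<open>d > 0\<close> by (auto simp: eventually_at_right_field)
qed

text \<open>The second difference is symmetric in \<open>p\<close> and \<open>q\<close>, so its
  limit can be computed in either order.\<close>

lemma second_derivative_symmetric:
  fixes u :: "'a::real_normed_vector \<Rightarrow> real"
  assumes "open U" and "z \<in> U"
    and "\<And>w. w \<in> U \<Longrightarrow> (u has_derivative u' w) (at w)"
    and "((\<lambda>w. u' w p) has_derivative A) (at z)"
    and "((\<lambda>w. u' w q) has_derivative B) (at z)"
  shows "A q = B p"
proof -
  have "((\<lambda>h. (u (z + h *\<^sub>R p + h *\<^sub>R q) - u (z + h *\<^sub>R p) - u (z + h *\<^sub>R q) + u z) / h\<^sup>2)
           \<longlongrightarrow> B p) (at_right 0)"
  proof -
    have *: "u (z + h *\<^sub>R p + h *\<^sub>R q) - u (z + h *\<^sub>R p) - u (z + h *\<^sub>R q) + u z =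
        u (z + h *\<^sub>R q + h *\<^sub>R p) - u (z + h *\<^sub>R q) - u (z + h *\<^sub>R p) + u z" for h
      by (simp add: add.assoc add.commute[of "h *\<^sub>R p"])
    show ?thesis
      unfolding * by (rule second_difference_tendsto[OF assms(1-3) assms(5)])
  qed
  moreover have "((\<lambda>h. (u (z + h *\<^sub>R p + h *\<^sub>R q) - u (z + h *\<^sub>R p) - u (z + h *\<^sub>R q) + u z) / h\<^sup>2)
           \<longlongrightarrow> A q) (at_right 0)"
    by (rule second_difference_tendsto[OF assms(1-3) assms(4)])
  ultimately show ?thesis
    using tendsto_unique[OF trivial_limit_at_right_real] by blast
qed

section \<open>Partial derivatives and components\<close>

lemma partials_eq:
  assumes "(f has_derivative f') (at z)"
  shows partial_x_eq: "partial_x f z = f' 1" and partial_y_eq: "partial_y f z = f' \<i>"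
proof -
  have *: "vector_derivative (\<lambda>t::real. f (z + c * of_real t)) (at 0) = f' c" for c
  proof (rule vector_derivative_at)
    have "((\<lambda>t::real. z + c * of_real t) has_derivative (\<lambda>t. c * of_real t)) (at 0)"
      by (auto intro!: derivative_eq_intros)
    then have "((\<lambda>t::real. f (z + c * of_real t)) has_derivative (\<lambda>t. f' (c * of_real t))) (at 0)"
      by (rule has_derivative_compose) (use assms in simp)
    moreover have "f' (c * of_real t) = t *\<^sub>R f' c" for t
      using linear_scale[OF has_derivative_linear[OF assms], of t c] by (simp add: scaleR_conv_of_real mult.commute)
    ultimately show "((\<lambda>t::real. f (z + c * of_real t)) has_vector_derivative f' c) (at 0)"
      by (simp add: has_vector_derivative_def)
  qed
  show "partial_x f z = f' 1" "partial_y f z = f' \<i>"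
    using *[of 1] *[of \<i>] by (simp_all add: partial_x_def partial_y_def)
qed

lemma has_derivative_partials:
  assumes "f differentiable (at z)"
  shows "(f has_derivative (\<lambda>v. Re v *\<^sub>R partial_x f z + Im v *\<^sub>R partial_y f z)) (at z)"
proof -
  obtain f' where f': "(f has_derivative f') (at z)" using assms by (auto simp: differentiable_def)
  have "f' v = Re v *\<^sub>R f' 1 + Im v *\<^sub>R f' \<i>" for v
  proof -
    have "f' v = f' (Re v *\<^sub>R 1 + Im v *\<^sub>R \<i>)"
      by (rule arg_cong[of _ _ f']) (simp add: complex_eq_iff)
    also have "\<dots> = Re v *\<^sub>R f' 1 + Im v *\<^sub>R f' \<i>"
      using has_derivative_linear[OF f'] by (simp only: linear_add linear_scale)
    finally show ?thesis .
  qed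
  then have "f' = (\<lambda>v. Re v *\<^sub>R partial_x f z + Im v *\<^sub>R partial_y f z)"
    unfolding partials_eq[OF f'] by (rule ext)
  then show ?thesis using f' by simp
qed

lemma has_derivative_vec_nth_iff:
  fixes f :: "'a::real_normed_vector \<Rightarrow> real ^ 'n"
  shows "(f has_derivative f') F \<longleftrightarrow> (\<forall>j. ((\<lambda>x. f x $ j) has_derivative (\<lambda>x. f' x $ j)) F)"
proof
  assume f: "(f has_derivative f') F"
  show "\<forall>j. ((\<lambda>x. f x $ j) has_derivative (\<lambda>x. f' x $ j)) F"
    using bounded_linear.has_derivative[OF bounded_linear_vec_nth f] by blast
next
  assume "\<forall>j. ((\<lambda>x. f x $ j) has_derivative (\<lambda>x. f' x $ j)) F"
  then have "((\<lambda>x. \<Sum>j\<in>UNIV. f x $ j *\<^sub>R (axis j 1 :: real ^ 'n)) has_derivative (\<lambda>x. \<Sum>j\<in>UNIV. f' x $ j *\<^sub>R (axis j 1 :: real ^ 'n))) F"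
    by (intro has_derivative_sum has_derivative_scaleR_left) auto
  moreover have "(\<Sum>j\<in>UNIV. x $ j *\<^sub>R axis j 1) = x" for x :: "real ^ 'n"
    by (simp add: vec_eq_iff axis_def if_distrib sum.delta cong: if_cong)
  ultimately show "(f has_derivative f') F" by simp
qed

section \<open>Holomorphic gradients of harmonic functions\<close>

text \<open>The function \<open>\<phi>\<close> encodes the gradient of \<open>u\<close> as \<open>u\<^sub>x - \<i> u\<^sub>y\<close>, which is
  holomorphic exactly when \<open>u\<close> is harmonic.\<close>

definition holo_gradient_on :: "complex set \<Rightarrow> (complex \<Rightarrow> real) \<Rightarrow> (complex \<Rightarrow> complex) \<Rightarrow> bool" where
  "holo_gradient_on U u \<phi> \<longleftrightarrow>
     \<phi> holomorphic_on U \<and> (\<forall>z\<in>U. (u has_derivative (\<lambda>v. Re (\<phi> z * v))) (at z))"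

lemma holo_gradient_on_cong:
  assumes "open U" and "holo_gradient_on U u \<phi>" and "\<And>z. z \<in> U \<Longrightarrow> u' z = u z"
  shows "holo_gradient_on U u' \<phi>"
  using assms has_derivative_transform_within_open[OF _ assms(1), of u _ _ UNIV u']
  by (simp add: holo_gradient_on_def)

lemma holo_gradient_on_subset:
  "holo_gradient_on U u \<phi> \<Longrightarrow> V \<subseteq> U \<Longrightarrow> holo_gradient_on V u \<phi>"
  unfolding holo_gradient_on_def using holomorphic_on_subset by blast

lemma has_derivative_Re:
  assumes "(\<Phi> has_field_derivative d) (at w)"
  shows "((\<lambda>w. Re (\<Phi> w)) has_derivative (\<lambda>v. Re (d * v))) (at w)"
  using bounded_linear.has_derivative[OF bounded_linear_Re] assms
  unfolding has_field_derivative_def by blast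

lemma holo_gradient_on_Re:
  assumes "open U" and "\<Phi> holomorphic_on U"
  shows "holo_gradient_on U (\<lambda>z. Re (\<Phi> z)) (deriv \<Phi>)"
  unfolding holo_gradient_on_def
proof (intro conjI ballI)
  show "deriv \<Phi> holomorphic_on U" using assms by (rule holomorphic_deriv[rotated])
  fix z assume "z \<in> U"
  then show "((\<lambda>z. Re (\<Phi> z)) has_derivative (\<lambda>v. Re (deriv \<Phi> z * v))) (at z)"
    using assms by (intro has_derivative_Re holomorphic_derivI)
qed

lemma holo_gradient_on_compose:
  assumes "holo_gradient_on U u \<phi>" and "open V" and "h holomorphic_on V" and "h ` V \<subseteq> U"
  shows "holo_gradient_on V (\<lambda>z. u (h z)) (\<lambda>z. \<phi> (h z) * deriv h z)"
  unfolding holo_gradient_on_def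
proof (intro conjI ballI)
  have \<phi>: "\<phi> holomorphic_on U" using assms(1) by (simp add: holo_gradient_on_def)
  have "(\<phi> \<circ> h) holomorphic_on V"
    using holomorphic_on_compose_gen[OF assms(3) \<phi>] assms(4) by blast
  then show "(\<lambda>z. \<phi> (h z) * deriv h z) holomorphic_on V"
    using assms(2,3) by (auto intro!: holomorphic_intros simp: o_def)
  fix z assume "z \<in> V"
  then have "(h has_derivative (\<lambda>v. deriv h z * v)) (at z)"
    using holomorphic_derivI[OF assms(3,2)] by (simp add: has_field_derivative_def)
  moreover have "(u has_derivative (\<lambda>v. Re (\<phi> (h z) * v))) (at (h z))"
    using assms(1,4) \<open>z \<in> V\<close> unfolding holo_gradient_on_def by blast
  ultimately have "((\<lambda>z. u (h z)) has_derivative (\<lambda>v. Re (\<phi> (h z) * (deriv h z * v)))) (at z)"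
    by (rule has_derivative_compose)
  then show "((\<lambda>z. u (h z)) has_derivative (\<lambda>v. Re (\<phi> (h z) * deriv h z * v))) (at z)"
    by (simp add: mult.assoc)
qed

text \<open>Reads the partials off \<open>\<phi> j\<close> by evaluating the derivative at 1 and
  \<open>\<i>\<close>. In \<open>CH_iff\<close> it is applied to \<open>f\<close> and again to its
  partials, which gives the second order derivatives.\<close>

lemma holo_gradient_on_imp_C1:
  fixes f :: "complex \<Rightarrow> real ^ 'n"
  assumes "open U" and g: "\<And>j. holo_gradient_on U (\<lambda>w. f w $ j) (\<phi> j)"
  shows "C1_map_on U f"
    and "z \<in> U \<Longrightarrow> partial_x f z = (\<chi> j. Re (\<phi> j z))"
    and "z \<in> U \<Longrightarrow> partial_y f z = (\<chi> j. Re (\<i> * \<phi> j z))"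
proof -
  have d: "(f has_derivative (\<lambda>v. \<chi> j. Re (\<phi> j z * v))) (at z)" if "z \<in> U" for z
    using g that by (simp add: has_derivative_vec_nth_iff holo_gradient_on_def)
  have x: "partial_x f z = (\<chi> j. Re (\<phi> j z))" if "z \<in> U" for z
    using partial_x_eq[OF d[OF that]] by simp
  have y: "partial_y f z = (\<chi> j. Re (\<i> * \<phi> j z))" if "z \<in> U" for z
    using partial_y_eq[OF d[OF that]] by (simp add: vec_eq_iff)
  have "\<And>j. continuous_on U (\<phi> j)"
    using g by (simp add: holo_gradient_on_def holomorphic_on_imp_continuous_on)
  then have "continuous_on U (\<lambda>z. \<chi> j. Re (\<phi> j z))" "continuous_on U (\<lambda>z. \<chi> j. Re (\<i> * \<phi> j z))"
    by (intro continuous_intros; assumption)+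
  then have "continuous_on U (partial_x f)" "continuous_on U (partial_y f)"
    using x y by (simp_all cong: continuous_on_cong)
  then show "C1_map_on U f" using d by (auto simp: C1_map_on_def differentiable_def)
  show "z \<in> U \<Longrightarrow> partial_x f z = (\<chi> j. Re (\<phi> j z))"
    "z \<in> U \<Longrightarrow> partial_y f z = (\<chi> j. Re (\<i> * \<phi> j z))" using x y by blast+
qed

section \<open>Conformal harmonic maps in holomorphic terms\<close>

text \<open>The sum equals \<open>|a|^2 - |b|^2 - 2 i (a . b)\<close>, so one complex equation
  carries both conformality conditions.\<close>

lemma sum_squares_gradients:
  fixes a b :: "real ^ 'n"
  assumes "\<And>j. c j = Complex (a $ j) (- (b $ j))"
  shows "(\<Sum>j\<in>UNIV. (c j)\<^sup>2) = 0 \<longleftrightarrow> norm a = norm b \<and> a \<bullet> b = 0"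
proof -
  have "(\<Sum>j\<in>UNIV. (c j)\<^sup>2) = Complex ((norm a)\<^sup>2 - (norm b)\<^sup>2) (- 2 * (a \<bullet> b))"
    unfolding power2_norm_eq_inner inner_vec_def
    by (simp add: assms complex_eq_iff power2_eq_square sum_subtractf sum_distrib_left flip: sum_negf)
  then show ?thesis by (simp add: complex_eq_iff power2_eq_iff_nonneg)
qed

text \<open>The Cauchy-Riemann equations for the components of \<open>f_x - i f_y\<close> are
  Laplace's equation and the symmetry of mixed partials. Conversely, complex derivatives of
  \<open>\<phi> j\<close> provide the second partials of \<open>f\<close>. All later arguments work
  with this description.\<close>

lemma CH_iff:
  fixes f :: "complex \<Rightarrow> real ^ 'n"
  assumes "open U"
  shows "f \<in> CH U \<Omega> \<longleftrightarrow> f ` U \<subseteq> \<Omega> \<and>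
    (\<exists>\<phi>. (\<forall>j. holo_gradient_on U (\<lambda>w. f w $ j) (\<phi> j)) \<and> (\<forall>z\<in>U. (\<Sum>j\<in>UNIV. (\<phi> j z)\<^sup>2) = 0))"
proof
  assume f: "f \<in> CH U \<Omega>"
  then have C1: "C1_map_on U f" "C1_map_on U (partial_x f)" "C1_map_on U (partial_y f)"
    and conf: "\<And>z. z \<in> U \<Longrightarrow> norm (partial_x f z) = norm (partial_y f z) \<and> partial_x f z \<bullet> partial_y f z = 0"
    and lap: "\<And>z. z \<in> U \<Longrightarrow> partial_x (partial_x f) z + partial_y (partial_y f) z = 0"
    by (auto simp: CH_def conformal_map_on_def harmonic_map_on_def C2_map_on_def)
  define \<phi> where "\<phi> j z = Complex (partial_x f z $ j) (- (partial_y f z $ j))" for j z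
  have D: "((\<lambda>w. g w $ j) has_derivative (\<lambda>v. Re v * partial_x g z $ j + Im v * partial_y g z $ j)) (at z)"
    if "C1_map_on U g" "z \<in> U" for g :: "complex \<Rightarrow> real ^ 'n" and z j
    using has_derivative_partials[of g z] that unfolding has_derivative_vec_nth_iff C1_map_on_def
    by simp
  have mixed: "partial_y (partial_x f) z $ j = partial_x (partial_y f) z $ j" if z: "z \<in> U" for z j
  proof -
    let ?u' = "\<lambda>w v. Re v * partial_x f w $ j + Im v * partial_y f w $ j"
    have "((\<lambda>w. ?u' w 1) has_derivative (\<lambda>v. Re v * partial_x (partial_x f) z $ j + Im v * partial_y (partial_x f) z $ j)) (at z)"
      "((\<lambda>w. ?u' w \<i>) has_derivative (\<lambda>v. Re v * partial_x (partial_y f) z $ j + Im v * partial_y (partial_y f) z $ j)) (at z)"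
      using D[OF C1(2) z] D[OF C1(3) z] by simp_all
    from second_derivative_symmetric[OF assms z D[OF C1(1)] this] show ?thesis by simp
  qed
  have "holo_gradient_on U (\<lambda>w. f w $ j) (\<phi> j)" for j
    unfolding holo_gradient_on_def
  proof (intro conjI ballI)
    show "\<phi> j holomorphic_on U"
      unfolding holomorphic_on_open[OF assms]
    proof
      fix z assume z: "z \<in> U"
      let ?a = "partial_x (partial_x f) z $ j" and ?b = "partial_x (partial_y f) z $ j"
      have "?a + partial_y (partial_y f) z $ j = 0"
        using arg_cong[OF lap[OF z], of "\<lambda>x. x $ j"] by simp
      then have l: "partial_y (partial_y f) z $ j = - ?a" by simp
      \<comment> \<open>By \<open>mixed\<close> and \<open>l\<close> this real derivative is complex
        linear, namely multiplication by \<open>Complex ?a (- ?b)\<close>.\<close>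
      have "((\<lambda>w. of_real (partial_x f w $ j) - \<i> * of_real (partial_y f w $ j)) has_derivative
          (\<lambda>v. of_real (Re v * ?a + Im v * ?b) - \<i> * of_real (Re v * ?b - Im v * ?a))) (at z)"
        using D[OF C1(2) z, of j] D[OF C1(3) z, of j] mixed[OF z, of j] l
        by (intro has_derivative_diff has_derivative_mult_right has_derivative_of_real) simp_all
      moreover have "(\<lambda>v. of_real (Re v * ?a + Im v * ?b) - \<i> * of_real (Re v * ?b - Im v * ?a)) = (*) (Complex ?a (- ?b))"
        by (auto simp: complex_eq_iff)
      moreover have "(\<lambda>w. of_real (partial_x f w $ j) - \<i> * of_real (partial_y f w $ j)) = \<phi> j"
        by (auto simp: \<phi>_def complex_eq_iff)
      ultimately show "\<exists>f'. (\<phi> j has_field_derivative f') (at z)"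
        by (auto simp: has_field_derivative_def)
    qed
    fix z assume "z \<in> U"
    then show "((\<lambda>w. f w $ j) has_derivative (\<lambda>v. Re (\<phi> j z * v))) (at z)"
      using D[OF C1(1), of z j] by (simp add: \<phi>_def mult.commute)
  qed
  moreover have "(\<Sum>j\<in>UNIV. (\<phi> j z)\<^sup>2) = 0" if "z \<in> U" for z
    using conf[OF that] sum_squares_gradients[of "\<lambda>j. \<phi> j z"] \<phi>_def by blast
  ultimately show "f ` U \<subseteq> \<Omega> \<and>
    (\<exists>\<phi>. (\<forall>j. holo_gradient_on U (\<lambda>w. f w $ j) (\<phi> j)) \<and> (\<forall>z\<in>U. (\<Sum>j\<in>UNIV. (\<phi> j z)\<^sup>2) = 0))"
    using f by (auto simp: CH_def)
next
  assume "f ` U \<subseteq> \<Omega> \<and>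
    (\<exists>\<phi>. (\<forall>j. holo_gradient_on U (\<lambda>w. f w $ j) (\<phi> j)) \<and> (\<forall>z\<in>U. (\<Sum>j\<in>UNIV. (\<phi> j z)\<^sup>2) = 0))"
  then obtain \<phi> where im: "f ` U \<subseteq> \<Omega>" and g: "\<And>j. holo_gradient_on U (\<lambda>w. f w $ j) (\<phi> j)"
    and sq: "\<And>z. z \<in> U \<Longrightarrow> (\<Sum>j\<in>UNIV. (\<phi> j z)\<^sup>2) = 0" by blast
  note f = holo_gradient_on_imp_C1[OF assms g]
  have hol: "\<phi> j holomorphic_on U" for j using g by (simp add: holo_gradient_on_def)
  have gx: "holo_gradient_on U (\<lambda>w. partial_x f w $ j) (deriv (\<phi> j))" for j
    by (rule holo_gradient_on_cong[OF assms holo_gradient_on_Re[OF assms hol]]) (simp add: f)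
  have gy: "holo_gradient_on U (\<lambda>w. partial_y f w $ j) (deriv (\<lambda>z. \<i> * \<phi> j z))" for j
    by (rule holo_gradient_on_cong[OF assms holo_gradient_on_Re[OF assms]])
      (auto simp: f intro!: holomorphic_intros hol)
  note fx = holo_gradient_on_imp_C1[OF assms gx] and fy = holo_gradient_on_imp_C1[OF assms gy]
  \<comment> \<open>Componentwise \<open>f_xx\<close> is the real part of
    \<open>deriv (\<phi> j) z\<close> and \<open>f_yy\<close> that of
    \<open>\<i> * \<i> * deriv (\<phi> j) z\<close>, so they cancel.\<close>
  have "deriv (\<lambda>z. \<i> * \<phi> j z) z = \<i> * deriv (\<phi> j) z" if "z \<in> U" for j z
    using holomorphic_on_imp_differentiable_at[OF hol assms that] by (rule deriv_cmult)
  then have "partial_x (partial_x f) z + partial_y (partial_y f) z = 0" if "z \<in> U" for z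
    using that by (simp add: fx fy vec_eq_iff)
  moreover have "norm (partial_x f z) = norm (partial_y f z) \<and> partial_x f z \<bullet> partial_y f z = 0" if "z \<in> U" for z
    using sq[OF that] f(2,3)[OF that] sum_squares_gradients[of "\<lambda>j. \<phi> j z" "partial_x f z" "partial_y f z"]
    by (simp add: complex_eq_iff)
  ultimately show "f \<in> CH U \<Omega>"
    using f(1) fx(1) fy(1) im
    by (simp add: CH_def conformal_map_on_def harmonic_map_on_def C2_map_on_def)
qed

text \<open>The chain rule multiplies every \<open>\<phi> j\<close> by \<open>deriv h\<close>, so
  the vanishing sum of squares is only multiplied by a square.\<close>

lemma CH_compose:
  fixes f :: "complex \<Rightarrow> real ^ 'n"
  assumes "f \<in> CH U \<Omega>" and "open U" and "open V" and "h holomorphic_on V" and "h ` V \<subseteq> U"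
  shows "(\<lambda>z. f (h z)) \<in> CH V \<Omega>"
proof -
  obtain \<phi> where "f ` U \<subseteq> \<Omega>" and g: "\<And>j. holo_gradient_on U (\<lambda>w. f w $ j) (\<phi> j)"
    and sq: "\<And>z. z \<in> U \<Longrightarrow> (\<Sum>j\<in>UNIV. (\<phi> j z)\<^sup>2) = 0"
    using assms(1) by (auto simp: CH_iff[OF \<open>open U\<close>])
  have "(\<Sum>j\<in>UNIV. (\<phi> j (h z) * deriv h z)\<^sup>2) = 0" if "z \<in> V" for z
    using sq[of "h z"] that assms(5) by (auto simp: power_mult_distrib simp flip: sum_distrib_right)
  moreover have "holo_gradient_on V (\<lambda>z. f (h z) $ j) (\<lambda>z. \<phi> j (h z) * deriv h z)" for j
    by (rule holo_gradient_on_compose[OF g assms(3-5)])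
  moreover have "(\<lambda>z. f (h z)) ` V \<subseteq> \<Omega>" using \<open>f ` U \<subseteq> \<Omega>\<close> assms(5) by blast
  ultimately show ?thesis unfolding CH_iff[OF \<open>open V\<close>]
    by (intro conjI exI[of _ "\<lambda>j z. \<phi> j (h z) * deriv h z"]) blast+
qed

lemma CH_has_derivative:
  assumes "f \<in> CH U \<Omega>" and "z \<in> U"
  obtains f' where "(f has_derivative f') (at z)"
  using assms by (auto simp: CH_def conformal_map_on_def C1_map_on_def differentiable_def)

section \<open>Upper bounds for the minimal pseudometric\<close>

lemma minimal_pseudometric_le:
  assumes "g \<in> CH unit_disc \<Omega>" and "g 0 = x" and "partial_x g 0 = (1 / M) *\<^sub>R v" and "M > 0"
  shows "minimal_pseudometric \<Omega> x v \<le> M"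
  unfolding minimal_pseudometric_def
proof (rule cInf_lower)
  show "M \<in> {1 / r | r. 1 / r > 0 \<and> (\<exists>f \<in> CH unit_disc \<Omega>. f 0 = x \<and> partial_x f 0 = r *\<^sub>R v)}"
    using assms by (intro CollectI exI[of _ "1 / M"]) auto
  show "bdd_below {1 / r | r. 1 / r > 0 \<and> (\<exists>f \<in> CH unit_disc \<Omega>. f 0 = x \<and> partial_x f 0 = r *\<^sub>R v)}"
    by (intro bdd_belowI[of _ 0]) auto
qed

text \<open>The competitor is a flat disc centred at \<open>x\<close>, spanned by
  \<open>a = v / M\<close> and an orthogonal vector \<open>b\<close> of the same length; dimension
  two leaves room for \<open>b\<close>, and that length is at most \<open>\<delta>\<close>.\<close>

lemma minimal_pseudometric_le_ball:
  fixes \<Omega> :: "(real ^ 'n) set"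
  assumes "CARD('n) \<ge> 2" and "ball x \<delta> \<subseteq> \<Omega>" and "\<delta> > 0" and "M > 0" and "norm v \<le> M * \<delta>"
  shows "minimal_pseudometric \<Omega> x v \<le> M"
proof -
  define a where "a = (1 / M) *\<^sub>R v"
  have na: "norm a \<le> \<delta>" using assms by (simp add: a_def field_simps)
  obtain y :: "real ^ 'n" where y: "y \<noteq> 0" "orthogonal a y"
    using orthogonal_to_vector_exists[of a] assms(1) by auto
  \<comment> \<open>For \<open>a = 0\<close> this gives \<open>b = 0\<close> and a constant disc,
    which is admissible because conformal maps need not be immersions.\<close>
  define b where "b = (norm a / norm y) *\<^sub>R y"
  have nb: "norm b = norm a" and ab: "a \<bullet> b = 0" using y by (auto simp: b_def orthogonal_def)
  define g where "g w = x + Re w *\<^sub>R a + Im w *\<^sub>R b" for w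
  have g: "holo_gradient_on unit_disc (\<lambda>w. g w $ j) (\<lambda>_. Complex (a $ j) (- (b $ j)))" for j
    unfolding holo_gradient_on_def g_def
    by (auto intro!: derivative_eq_intros simp: fun_eq_iff)
  have "(\<Sum>j\<in>UNIV. (Complex (a $ j) (- (b $ j)))\<^sup>2) = 0"
    using sum_squares_gradients[of _ a b] nb ab by simp
  moreover have "g w \<in> \<Omega>" if "w \<in> unit_disc" for w
  proof -
    have "(norm (Re w *\<^sub>R a + Im w *\<^sub>R b))\<^sup>2 = (Re w)\<^sup>2 * (norm a)\<^sup>2 + (Im w)\<^sup>2 * (norm b)\<^sup>2"
      using norm_add_Pythagorean[of "Re w *\<^sub>R a" "Im w *\<^sub>R b"] ab
      by (simp add: orthogonal_def power_mult_distrib)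
    also have "\<dots> = (norm w * norm a)\<^sup>2"
      by (simp add: nb cmod_power2 power_mult_distrib distrib_right)
    finally have "norm (Re w *\<^sub>R a + Im w *\<^sub>R b) = norm w * norm a"
      by (simp add: power2_eq_iff_nonneg)
    also have "\<dots> \<le> norm w * \<delta>" using na by (simp add: mult_left_mono)
    also have "\<dots> < \<delta>" using that \<open>\<delta> > 0\<close> by simp
    finally have "dist x (g w) < \<delta>"
      by (subst dist_commute) (simp add: g_def dist_norm add.assoc)
    then show ?thesis using assms(2) by auto
  qed
  ultimately have "g \<in> CH unit_disc \<Omega>" unfolding CH_iff[OF open_ball]
    by (intro conjI exI[of _ "\<lambda>j _. Complex (a $ j) (- (b $ j))"]) (use g in auto)
  moreover have "partial_x g 0 = (1 / M) *\<^sub>R v"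
    using holo_gradient_on_imp_C1(2)[OF open_ball g, of 0] by (simp add: a_def vec_eq_iff)
  ultimately show ?thesis using minimal_pseudometric_le[of g] \<open>M > 0\<close> by (simp add: g_def)
qed

text \<open>The disc \<open>\<zeta> \<mapsto> z exp (c \<zeta> / M)\<close> stays in the punctured disc because \<open>log\<close> maps it
  into the left half-plane; this replaces the Poincare metric of the punctured disc.\<close>

lemma minimal_pseudometric_le_punctured:
  fixes f :: "complex \<Rightarrow> real ^ 'n"
  assumes f: "f \<in> CH (unit_disc - {0}) \<Omega>" and z: "z \<in> unit_disc - {0}"
    and f': "(f has_derivative f') (at z)"
    and "M > 0" and c: "norm c \<le> M * - ln (norm z)"
  shows "minimal_pseudometric \<Omega> (f z) (f' (c * z)) \<le> M"
proof -
  define h where "h w = z * exp (c / of_real M * w)" for w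
  have L: "ln (norm z) < 0" using z by simp
  have "norm (h w) < 1" if "norm w < 1" for w
  proof -
    \<comment> \<open>Since \<open>norm (h w) = norm z * exp (Re (c / of_real M * w))\<close>, it
      suffices to keep the exponent below \<open>- ln (norm z)\<close>.\<close>
    have "Re (c / of_real M * w) \<le> norm (c / of_real M * w)" by (rule complex_Re_le_cmod)
    also have "\<dots> = norm c / M * norm w" using \<open>M > 0\<close> by (simp add: norm_mult norm_divide)
    also have "\<dots> \<le> - ln (norm z) * norm w"
      using c \<open>M > 0\<close> by (intro mult_right_mono) (auto simp: field_simps)
    also have "\<dots> < - ln (norm z)"
      using L that by (simp add: mult_less_cancel_left)
    finally have "exp (Re (c / of_real M * w)) < exp (- ln (norm z))" by simp
    also have "\<dots> = 1 / norm z" using z by (simp add: exp_minus inverse_eq_divide)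
    finally show ?thesis using z by (simp add: h_def norm_mult field_simps)
  qed
  then have im: "h ` unit_disc \<subseteq> unit_disc - {0}"
    using z by (auto simp: h_def)
  have h: "h holomorphic_on unit_disc" unfolding h_def by (intro holomorphic_intros) (use \<open>M > 0\<close> in auto)
  have "(h has_field_derivative c / of_real M * z) (at 0)"
    unfolding h_def by (rule derivative_eq_intros refl | simp)+
  then have "(h has_derivative (\<lambda>v. c / of_real M * z * v)) (at 0)"
    by (simp only: has_field_derivative_def)
  moreover have "(f has_derivative f') (at (h 0))" using f' by (simp add: h_def)
  ultimately have "((\<lambda>w. f (h w)) has_derivative (\<lambda>v. f' (c / of_real M * z * v))) (at 0)"
    by (rule has_derivative_compose)
  then have "partial_x (\<lambda>w. f (h w)) 0 = f' (c / of_real M * z)"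
    by (simp add: partial_x_eq)
  also have "c / of_real M * z = (1 / M) *\<^sub>R (c * z)" by (simp add: scaleR_conv_of_real)
  also have "f' \<dots> = (1 / M) *\<^sub>R f' (c * z)"
    by (rule linear_scale[OF has_derivative_linear[OF f']])
  finally show ?thesis
    using minimal_pseudometric_le[OF CH_compose[OF f _ open_ball h im]] \<open>M > 0\<close>
    by (simp add: h_def open_delete)
qed

section \<open>Smooth pieces and lengths of paths\<close>

lemma smooth_on_interval_affine:
  assumes "\<And>t. t \<in> {a..b} \<Longrightarrow> \<gamma> t = x + t *\<^sub>R v"
  shows "smooth_on_interval a b \<gamma>"
proof -
  define D where "D k t = (if k = 0 then x + t *\<^sub>R v else if k = 1 then v else 0)" for k :: nat and t
  have "((\<lambda>t. x + t *\<^sub>R v) has_vector_derivative v) (at t within S)" for t S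
    by (auto intro!: derivative_eq_intros)
  moreover have "D 0 = (\<lambda>t. x + t *\<^sub>R v)" "D (Suc k) = (\<lambda>_. if k = 0 then v else 0)" for k
    by (simp_all add: D_def fun_eq_iff)
  ultimately have "(D k has_vector_derivative D (Suc k) t) (at t within {a..b})" for k t
    by (cases k) simp_all
  then show ?thesis unfolding smooth_on_interval_def
    using assms by (intro exI[of _ D]) (simp add: D_def)
qed

text \<open>Along the real axis the components of the velocity are the real parts of
  \<open>\<phi> j\<close>, and every further real derivative becomes a complex derivative of
  \<open>\<phi> j\<close>.\<close>

lemma smooth_on_interval_CH:
  fixes f :: "complex \<Rightarrow> real ^ 'n"
  assumes f: "f \<in> CH U \<Omega>" and "open U" and "\<And>t. t \<in> {a..b} \<Longrightarrow> complex_of_real t \<in> U"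
    and \<gamma>: "\<And>t. t \<in> {a..b} \<Longrightarrow> \<gamma> t = f (of_real t)"
  shows "smooth_on_interval a b \<gamma>"
proof -
  obtain \<phi> where g: "\<And>j. holo_gradient_on U (\<lambda>w. f w $ j) (\<phi> j)"
    using f by (auto simp: CH_iff[OF \<open>open U\<close>])
  have hol: "(deriv ^^ k) (\<phi> j) holomorphic_on U" for j k
    using g \<open>open U\<close> by (auto simp: holo_gradient_on_def intro: holomorphic_higher_deriv)
  \<comment> \<open>The index is shifted by one because \<open>\<phi> j\<close> already stands for
    the first derivative of \<open>f\<close>.\<close>
  define D where "D k t = (case k of 0 \<Rightarrow> f (of_real t) | Suc k \<Rightarrow> (\<chi> j. Re ((deriv ^^ k) (\<phi> j) (of_real t))))"
    for k :: nat and t :: real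
  have *: "((\<lambda>t. h (of_real t)) has_vector_derivative (\<chi> j. Re (\<psi> j (of_real t)))) (at t within {a..b})"
    if "\<And>j. holo_gradient_on U (\<lambda>w. h w $ j) (\<psi> j)" "t \<in> {a..b}"
    for h :: "complex \<Rightarrow> real ^ 'n" and \<psi> t
  proof -
    have "(h has_derivative (\<lambda>v. \<chi> j. Re (\<psi> j (of_real t) * v))) (at (of_real t))"
      using that assms(3) by (simp add: has_derivative_vec_nth_iff holo_gradient_on_def)
    moreover have "(of_real has_derivative complex_of_real) (at t within {a..b})"
      by (auto intro!: derivative_eq_intros)
    ultimately have "((\<lambda>t. h (of_real t)) has_derivative (\<lambda>v. \<chi> j. Re (\<psi> j (of_real t) * of_real v))) (at t within {a..b})"
      using has_derivative_compose by blast
    moreover have "(\<lambda>v. \<chi> j. Re (\<psi> j (of_real t) * of_real v)) = (\<lambda>v. v *\<^sub>R (\<chi> j. Re (\<psi> j (of_real t))))"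
      by (simp add: fun_eq_iff vec_eq_iff)
    ultimately show ?thesis by (simp add: has_vector_derivative_def)
  qed
  have "(D k has_vector_derivative D (Suc k) t) (at t within {a..b})" if "t \<in> {a..b}" for k t
  proof (cases k)
    case 0
    have "D 0 = (\<lambda>t. f (of_real t))" by (simp add: D_def fun_eq_iff)
    then show ?thesis using *[OF g that] 0 by (simp add: D_def)
  next
    case (Suc n)
    have "D (Suc n) = (\<lambda>t. \<chi> j. Re ((deriv ^^ n) (\<phi> j) (of_real t)))" by (simp add: D_def fun_eq_iff)
    moreover have "holo_gradient_on U (\<lambda>w. (\<chi> j. Re ((deriv ^^ n) (\<phi> j) w)) $ j) ((deriv ^^ Suc n) (\<phi> j))" for j
      using holo_gradient_on_Re[OF \<open>open U\<close> hol] by simp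
    from *[OF this that] have "((\<lambda>t. \<chi> j. Re ((deriv ^^ n) (\<phi> j) (of_real t))) has_vector_derivative
        (\<chi> j. Re ((deriv ^^ Suc n) (\<phi> j) (of_real t)))) (at t within {a..b})" .
    ultimately show ?thesis using Suc by (simp add: D_def)
  qed
  then show ?thesis unfolding smooth_on_interval_def
    using \<gamma> by (intro exI[of _ D]) (simp add: D_def)
qed

text \<open>The parameter interval has length one, so a bound on the speed bounds the length;
  \<open>K\<close> is a null set that absorbs the partition points.\<close>

lemma minimal_length_le:
  assumes "finite K" and "\<And>t. t \<in> {0..1} - K \<Longrightarrow> minimal_pseudometric \<Omega> (\<gamma> t) (vector_derivative \<gamma> (at t)) \<le> M"
  shows "minimal_length \<Omega> \<gamma> \<le> ennreal M"
proof -
  have "AE t in lborel. t \<notin> K"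
    using AE_not_in[of K lborel] finite_imp_null_set_lborel[OF assms(1)] by blast
  then have "minimal_length \<Omega> \<gamma> \<le> (\<integral>\<^sup>+t\<in>{0..1::real}. ennreal M \<partial>lborel)"
    unfolding minimal_length_def
    by (intro nn_integral_mono_AE, elim eventually_mono) (use assms(2) in \<open>auto simp: indicator_def intro: ennreal_leI\<close>)
  also have "\<dots> = ennreal M" by (simp add: nn_integral_cmult_indicator)
  finally show ?thesis .
qed

section \<open>Short connections along circles\<close>

text \<open>The path runs straight from \<open>p\<close> to \<open>f z\<close>, then along the image
  of a circular arc to \<open>f w\<close>, then straight to \<open>q\<close>. Each piece takes time
  one third, whence the factors 3. The segments are controlled by flat discs and the arc by
  exponential discs.\<close>

lemma pseudodistance_le:
  fixes f :: "complex \<Rightarrow> real ^ 'n"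
  assumes card: "CARD('n) \<ge> 2" and f: "f \<in> CH (unit_disc - {0}) \<Omega>"
    and z: "z \<in> unit_disc - {0}" and w: "norm w = norm z"
    and "\<epsilon> > 0" and balls: "\<And>x. x \<in> cball p \<epsilon> \<Longrightarrow> ball x \<epsilon> \<subseteq> \<Omega>"
    and pts: "f z \<in> cball p \<epsilon>" "f w \<in> cball p \<epsilon>" "q \<in> cball p \<epsilon>"
    and "M > 0" and M1: "3 * norm (f z - p) \<le> M * \<epsilon>" and M2: "3 * norm (q - f w) \<le> M * \<epsilon>"
    and M3: "3 * pi \<le> M * - ln (norm z)"
  shows "minimal_pseudodistance \<Omega> p q \<le> ennreal M"
proof -
  let ?P = "unit_disc - {0::complex}"
  have opP: "open ?P" by (simp add: open_delete)
  define \<alpha> where "\<alpha> = Arg (w / z)"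
  have "\<bar>\<alpha>\<bar> \<le> pi" using Arg_bounded[of "w / z"] by (auto simp: \<alpha>_def)
  have "w \<noteq> 0" using z w by auto
  then have "w / z = cis \<alpha>" using cis_Arg[of "w / z"] z w
    by (auto simp: \<alpha>_def sgn_eq norm_divide)
  then have wz: "w = z * exp (\<i> * \<alpha>)" using z by (simp add: cis_conv_exp field_simps)
  \<comment> \<open>The angle grows from 0 to \<open>\<alpha>\<close> as \<open>t\<close> goes from
    1/3 to 2/3. The parameter is complex so that \<open>f\<close> composed with \<open>e\<close> is
    again conformal harmonic, near the real line, and hence smooth there.\<close>
  define e where "e t = z * exp (\<i> * \<alpha> * (3 * t - 1))" for t :: complex
  have norm_e: "norm (e (of_real t)) = norm z" for t
  proof -
    have "Re (\<i> * \<alpha> * (3 * complex_of_real t - 1)) = 0" by simp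
    then show ?thesis unfolding e_def by (simp only: norm_mult norm_exp_eq_Re) simp
  qed
  have eP: "e (of_real t) \<in> ?P" for t using norm_e[of t] z by auto
  have e_ends: "e (of_real (1/3)) = z" "e (of_real (2/3)) = w" using wz by (simp_all add: e_def)
  have hol_e: "e holomorphic_on UNIV" unfolding e_def by (intro holomorphic_intros)
  define V where "V = e -` ?P"
  have "open V" unfolding V_def
    using opP hol_e by (intro open_vimage) (auto dest: holomorphic_on_imp_continuous_on)
  have fe: "(\<lambda>t. f (e t)) \<in> CH V \<Omega>"
    by (rule CH_compose[OF f opP \<open>open V\<close>]) (auto simp: V_def intro: holomorphic_on_subset[OF hol_e])
  define \<gamma> where "\<gamma> t = (if t \<le> 1/3 then p + (3 * t) *\<^sub>R (f z - p)
      else if t \<le> 2/3 then f (e (of_real t)) else f w + (3 * t - 2) *\<^sub>R (q - f w))" for t :: real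
  \<comment> \<open>The branches of \<open>\<gamma>\<close> agree at 1/3 and 2/3, so each formula
    holds on its closed interval, as the definition of piecewise smoothness demands.\<close>
  have mid: "\<gamma> t = f (e (of_real t))" if "t \<in> {1/3..2/3}" for t
  proof (cases "t = 1/3")
    case True
    have "\<gamma> (1/3) = f z" by (simp add: \<gamma>_def)
    then show ?thesis unfolding True e_ends .
  qed (use that in \<open>auto simp: \<gamma>_def\<close>)
  have right: "\<gamma> t = f w + (3 * t - 2) *\<^sub>R (q - f w)" if "t \<in> {2/3..1}" for t
  proof (cases "t = 2/3")
    case True
    have "\<gamma> (2/3) = f (e (of_real (2/3)))" by (simp add: \<gamma>_def)
    then show ?thesis unfolding True e_ends by simp
  qed (use that in \<open>auto simp: \<gamma>_def\<close>)
  have s1: "smooth_on_interval 0 (1/3) \<gamma>"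
    by (rule smooth_on_interval_affine[of _ _ _ p "3 *\<^sub>R (f z - p)"]) (simp add: \<gamma>_def mult.commute)
  have s2: "smooth_on_interval (1/3) (2/3) \<gamma>"
    by (rule smooth_on_interval_CH[OF fe \<open>open V\<close>]) (use eP mid in \<open>auto simp: V_def\<close>)
  have s3: "smooth_on_interval (2/3) 1 \<gamma>"
    by (rule smooth_on_interval_affine[of _ _ _ "f w - 2 *\<^sub>R (q - f w)" "3 *\<^sub>R (q - f w)"])
      (simp add: right algebra_simps)
  have "piecewise_smooth_path \<gamma>"
    unfolding piecewise_smooth_path_def
  proof (intro exI[of _ 3] exI[of _ "\<lambda>i. real i / 3"] conjI allI impI)
    fix i :: nat assume "i < 3"
    then consider "i = 0" | "i = 1" | "i = 2" by linarith
    then show "smooth_on_interval (real i / 3) (real (Suc i) / 3) \<gamma>"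
      by cases (use s1 s2 s3 in auto)
  qed (auto simp: divide_strict_right_mono)
  have ballp: "cball p \<epsilon> \<subseteq> \<Omega>" using balls \<open>\<epsilon> > 0\<close> by (meson centre_in_ball subset_iff)
  have seg: "x + s *\<^sub>R (y - x) \<in> cball p \<epsilon>" if "x \<in> cball p \<epsilon>" "y \<in> cball p \<epsilon>" "0 \<le> s" "s \<le> 1" for x y s
    using convexD_alt[OF convex_cball that] by (simp add: algebra_simps)
  have l: "\<gamma> t \<in> cball p \<epsilon>" if "t \<in> {0..1/3}" for t
    using seg[of p "f z" "3 * t"] that pts \<open>\<epsilon> > 0\<close> by (simp add: \<gamma>_def)
  have r: "\<gamma> t \<in> cball p \<epsilon>" if "t \<in> {2/3..1}" for t
    using seg[of "f w" q "3 * t - 2"] that pts \<open>\<epsilon> > 0\<close> by (simp add: right)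
  have "\<gamma> t \<in> \<Omega>" if "t \<in> {0..1}" for t
  proof -
    consider "t \<le> 1/3" | "1/3 \<le> t" "t \<le> 2/3" | "2/3 \<le> t" by linarith
    then show ?thesis
    proof cases
      case 2
      then show ?thesis using mid eP f by (auto simp: CH_def)
    qed (use that l[of t] r[of t] ballp in auto)
  qed
  then have "path_image \<gamma> \<subseteq> \<Omega>" by (auto simp: path_image_def)
  have "minimal_length \<Omega> \<gamma> \<le> ennreal M"
  proof (rule minimal_length_le[of "{1/3, 2/3}"])
    fix t :: real assume "t \<in> {0..1} - {1/3, 2/3}"
    then have t: "0 \<le> t" "t \<le> 1" "t \<noteq> 1/3" "t \<noteq> 2/3" by auto
    then consider "t < 1/3" | "1/3 < t" "t < 2/3" | "2/3 < t" by linarith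
    then show "minimal_pseudometric \<Omega> (\<gamma> t) (vector_derivative \<gamma> (at t)) \<le> M"
    proof cases
      case 1
      have "((\<lambda>t. p + (3 * t) *\<^sub>R (f z - p)) has_vector_derivative 3 *\<^sub>R (f z - p)) (at t)"
        by (auto intro!: derivative_eq_intros)
      then have "(\<gamma> has_vector_derivative 3 *\<^sub>R (f z - p)) (at t)"
        by (rule has_vector_derivative_transform_within_open[of _ _ _ "{..<1/3}"])
          (use 1 in \<open>auto simp: \<gamma>_def\<close>)
      then have "vector_derivative \<gamma> (at t) = 3 *\<^sub>R (f z - p)" by (rule vector_derivative_at)
      then show ?thesis
        using minimal_pseudometric_le_ball[OF card balls[OF l] \<open>\<epsilon> > 0\<close> \<open>M > 0\<close>] 1 t M1 by simp
    next
      case 2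
      obtain f' where f': "(f has_derivative f') (at (e (of_real t)))"
        using CH_has_derivative[OF f eP] by blast
      have "(e has_field_derivative 3 * \<i> * \<alpha> * e (of_real t)) (at (of_real t))"
        unfolding e_def by (rule derivative_eq_intros refl | simp)+
      then have "(e has_derivative (*) (3 * \<i> * \<alpha> * e (of_real t))) (at (of_real t))"
        by (simp only: has_field_derivative_def)
      moreover have "(of_real has_derivative complex_of_real) (at t)"
        by (auto intro!: derivative_eq_intros)
      ultimately have "((\<lambda>t. e (of_real t)) has_derivative (\<lambda>v. 3 * \<i> * \<alpha> * e (of_real t) * of_real v)) (at t)"
        using has_derivative_compose by blast
      then have "((\<lambda>t. e (of_real t)) has_derivative (\<lambda>v. v *\<^sub>R (3 * \<i> * \<alpha> * e (of_real t)))) (at t)"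
        by (simp add: scaleR_conv_of_real mult.commute)
      then have "((\<lambda>t. f (e (of_real t))) has_derivative (\<lambda>v. f' (v *\<^sub>R (3 * \<i> * \<alpha> * e (of_real t))))) (at t)"
        by (rule has_derivative_compose) (rule f')
      then have "((\<lambda>t. f (e (of_real t))) has_vector_derivative f' (3 * \<i> * \<alpha> * e (of_real t))) (at t)"
        by (simp only: linear_scale[OF has_derivative_linear[OF f']] has_vector_derivative_def)
      then have "(\<gamma> has_vector_derivative f' (3 * \<i> * \<alpha> * e (of_real t))) (at t)"
        by (rule has_vector_derivative_transform_within_open[of _ _ _ "{1/3<..<2/3}"])
          (use 2 mid in auto)
      then have vd: "vector_derivative \<gamma> (at t) = f' (3 * \<i> * \<alpha> * e (of_real t))" by (rule vector_derivative_at)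
      \<comment> \<open>The arc stays at modulus \<open>norm z\<close> and its angle is at most
        \<open>pi\<close>, so \<open>M3\<close> is exactly what the exponential disc
        requires.\<close>
      have "norm (3 * \<i> * \<alpha>) \<le> M * - ln (norm (e (of_real t)))"
        using M3 \<open>\<bar>\<alpha>\<bar> \<le> pi\<close> unfolding norm_e by (simp add: norm_mult)
      from minimal_pseudometric_le_punctured[OF f eP f' \<open>M > 0\<close> this]
      show ?thesis using mid[of t] 2 vd by simp
    next
      case 3
      have "((\<lambda>t. f w + (3 * t - 2) *\<^sub>R (q - f w)) has_vector_derivative 3 *\<^sub>R (q - f w)) (at t)"
        by (auto intro!: derivative_eq_intros)
      then have "(\<gamma> has_vector_derivative 3 *\<^sub>R (q - f w)) (at t)"
        by (rule has_vector_derivative_transform_within_open[of _ _ _ "{2/3<..}"])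
          (use 3 in \<open>auto simp: \<gamma>_def\<close>)
      then have "vector_derivative \<gamma> (at t) = 3 *\<^sub>R (q - f w)" by (rule vector_derivative_at)
      then show ?thesis
        using minimal_pseudometric_le_ball[OF card balls[OF r] \<open>\<epsilon> > 0\<close> \<open>M > 0\<close>] 3 t M2 by simp
    qed
  qed simp
  moreover have "pathstart \<gamma> = p" "pathfinish \<gamma> = q"
    by (simp_all add: \<gamma>_def pathstart_def pathfinish_def)
  ultimately show ?thesis unfolding minimal_pseudodistance_def
    using \<open>piecewise_smooth_path \<gamma>\<close> \<open>path_image \<gamma> \<subseteq> \<Omega>\<close> by (blast intro: Inf_lower2)
qed

section \<open>Harmonic functions on discs, annuli and punctured discs\<close>

text \<open>On a convex set \<open>\<phi>\<close> has a primitive; its real part differs from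
  \<open>u\<close> by a constant, because the derivatives agree, and \<open>\<Psi>\<close> absorbs
  that constant.\<close>

lemma holo_gradient_on_ball_primitive:
  assumes "holo_gradient_on (ball z r) u \<phi>" and "r > 0"
  obtains \<Psi> where "\<And>w. w \<in> ball z r \<Longrightarrow> (\<Psi> has_field_derivative \<phi> w) (at w)"
    and "\<And>w. w \<in> ball z r \<Longrightarrow> u w = Re (\<Psi> w)"
proof -
  obtain \<Phi> where \<Phi>: "\<And>w. w \<in> ball z r \<Longrightarrow> (\<Phi> has_field_derivative \<phi> w) (at w)"
  proof (rule holomorphic_convex_primitive'[OF convex_ball open_ball])
    show "\<phi> holomorphic_on ball z r" using assms(1) by (simp add: holo_gradient_on_def)
  qed (use that at_within_open[OF _ open_ball] in fastforce)
  have "((\<lambda>w. u w - Re (\<Phi> w)) has_derivative (\<lambda>h. 0)) (at w within ball z r)" if "w \<in> ball z r" for w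
  proof -
    have "((\<lambda>w. Re (\<Phi> w)) has_derivative (\<lambda>v. Re (\<phi> w * v))) (at w)"
      by (rule has_derivative_Re[OF \<Phi>[OF that]])
    moreover have "(u has_derivative (\<lambda>v. Re (\<phi> w * v))) (at w)"
      using assms(1) that by (simp add: holo_gradient_on_def)
    ultimately have "((\<lambda>w. u w - Re (\<Phi> w)) has_derivative (\<lambda>v. Re (\<phi> w * v) - Re (\<phi> w * v))) (at w)"
      by (rule has_derivative_diff[rotated])
    then show ?thesis by (simp add: has_derivative_at_withinI)
  qed
  then obtain c where c: "\<And>w. w \<in> ball z r \<Longrightarrow> u w - Re (\<Phi> w) = c"
    using has_derivative_zero_constant[OF convex_ball, of z r "\<lambda>w. u w - Re (\<Phi> w)"] by blast
  show ?thesis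
  proof
    fix w assume w: "w \<in> ball z r"
    show "((\<lambda>w. \<Phi> w + of_real c) has_field_derivative \<phi> w) (at w)"
      using \<Phi>[OF w] by (auto intro!: derivative_eq_intros)
    show "u w = Re (\<Phi> w + of_real c)" using c[OF w] by simp
  qed
qed

lemma holo_gradient_on_diff_const:
  "holo_gradient_on U u \<phi> \<Longrightarrow> holo_gradient_on U (\<lambda>w. u w - c) \<phi>"
  unfolding holo_gradient_on_def by (auto intro!: derivative_eq_intros)

lemma holo_gradient_on_uminus:
  "holo_gradient_on U u \<phi> \<Longrightarrow> holo_gradient_on U (\<lambda>w. - u w) (\<lambda>w. - \<phi> w)"
  unfolding holo_gradient_on_def by (auto intro!: derivative_eq_intros holomorphic_intros)

lemma holo_gradient_on_continuous:
  "holo_gradient_on U u \<phi> \<Longrightarrow> continuous_on U u"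
  unfolding holo_gradient_on_def
  by (intro continuous_at_imp_continuous_on ballI) (blast intro: has_derivative_continuous)

text \<open>Cauchy's estimate for \<open>exp (\<Psi> / B)\<close>, which takes values of modulus between
  \<open>1 / e\<close> and \<open>e\<close> when \<open>u = Re \<Psi>\<close>.\<close>

lemma gradient_estimate:
  assumes g: "holo_gradient_on (ball z r) u \<phi>" and "r > 0" and "B > 0"
    and B: "\<And>w. w \<in> ball z r \<Longrightarrow> \<bar>u w\<bar> \<le> B"
  shows "norm (\<phi> z) \<le> 2 * (exp 1)\<^sup>2 * B / r"
proof -
  obtain \<Psi> where \<Psi>: "\<And>w. w \<in> ball z r \<Longrightarrow> (\<Psi> has_field_derivative \<phi> w) (at w)"
    and u: "\<And>w. w \<in> ball z r \<Longrightarrow> u w = Re (\<Psi> w)"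
    using holo_gradient_on_ball_primitive[OF g \<open>r > 0\<close>] by blast
  define G where "G w = exp (\<Psi> w / of_real B)" for w
  have G': "(G has_field_derivative G w * (\<phi> w / of_real B)) (at w)" if "w \<in> ball z r" for w
    unfolding G_def by (intro DERIV_fun_exp DERIV_cdivide \<Psi> that)
  have nG: "norm (G w) = exp (u w / B)" if "w \<in> ball z r" for w
    using u[OF that] by (simp add: G_def norm_exp_eq_Re)
  have hol: "G holomorphic_on ball z r"
    unfolding holomorphic_on_open[OF open_ball] using G' by blast
  have sub: "cball z (r / 2) \<subseteq> ball z r" using \<open>r > 0\<close> by auto
  \<comment> \<open>Halving the radius gives a closed disc inside the open ball and costs the factor
    2 of the estimate.\<close>
  have "norm ((deriv ^^ 1) G z) \<le> fact 1 * exp 1 / (r / 2) ^ 1"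
  proof (rule Cauchy_inequality)
    show "G holomorphic_on ball z (r / 2)"
      by (rule holomorphic_on_subset[OF hol order_trans[OF ball_subset_cball sub]])
    show "continuous_on (cball z (r / 2)) G"
      by (rule continuous_on_subset[OF holomorphic_on_imp_continuous_on[OF hol] sub])
    fix w assume "norm (z - w) = r / 2"
    then have w: "w \<in> ball z r" using \<open>r > 0\<close> by (simp add: dist_norm)
    have "u w / B \<le> 1" using B[OF w] \<open>B > 0\<close> by (simp add: field_simps)
    then show "norm (G w) \<le> exp 1" using nG[OF w] by simp
  qed (use \<open>r > 0\<close> in simp)
  moreover have z: "z \<in> ball z r" using \<open>r > 0\<close> by simp
  moreover have "deriv G z = G z * (\<phi> z / of_real B)" using G'[OF z] by (rule DERIV_imp_deriv)
  ultimately have "exp (u z / B) * (norm (\<phi> z) / B) \<le> 2 * exp 1 / r"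
    using nG[OF z] \<open>B > 0\<close> by (simp add: norm_mult norm_divide mult.commute)
  \<comment> \<open>The lower bound for \<open>norm (G z)\<close> allows division by it; this costs
    the second factor \<open>exp 1\<close>.\<close>
  moreover have "exp (- 1) \<le> exp (u z / B)"
    using B[OF z] \<open>B > 0\<close> by (simp add: field_simps)
  then have "exp (- 1) * (norm (\<phi> z) / B) \<le> exp (u z / B) * (norm (\<phi> z) / B)"
    using \<open>B > 0\<close> by (intro mult_right_mono) auto
  ultimately have "exp (- 1) * (norm (\<phi> z) / B) \<le> 2 * exp 1 / r" by linarith
  then have "exp 1 * (exp (- 1) * (norm (\<phi> z) / B)) \<le> exp 1 * (2 * exp 1 / r)"
    by (intro mult_left_mono) auto
  moreover have "exp 1 * (exp (- 1) * (norm (\<phi> z) / B)) = norm (\<phi> z) / B"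
    by (simp add: exp_minus)
  moreover have "exp 1 * (2 * exp 1 / r) = 2 * (exp 1)\<^sup>2 / r"
    by (simp add: power2_eq_square)
  ultimately have "norm (\<phi> z) / B \<le> 2 * (exp 1)\<^sup>2 / r"
    by (simp only:)
  then show ?thesis using \<open>B > 0\<close> by (simp add: pos_divide_le_eq)
qed

text \<open>Among the points where the maximum is attained take one of largest modulus: \<open>u\<close> is locally
  constant there, by the maximum modulus principle for \<open>exp \<Psi>\<close> with \<open>u = Re \<Psi>\<close>.\<close>

lemma annulus_maximum_principle:
  assumes g: "holo_gradient_on U u \<phi>" and A: "{w. r \<le> norm w \<and> norm w \<le> R} \<subseteq> U"
    and bd: "\<And>w. norm w = r \<or> norm w = R \<Longrightarrow> u w \<le> B"
    and z: "r \<le> norm z" "norm z \<le> R"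
  shows "u z \<le> B"
proof (rule ccontr)
  assume "\<not> u z \<le> B"
  define A where "A = {w::complex. r \<le> norm w \<and> norm w \<le> R}"
  have "closed A" unfolding A_def
    by (intro closed_Collect_conj closed_Collect_le continuous_intros)
  moreover have "bounded A" by (rule boundedI[of _ R]) (simp add: A_def)
  ultimately have "compact A" by (simp add: compact_eq_bounded_closed)
  have contu: "continuous_on A u"
    using continuous_on_subset[OF holo_gradient_on_continuous[OF g]] A by (simp add: A_def)
  have "z \<in> A" using z by (simp add: A_def)
  obtain m where m: "m \<in> A" "\<And>w. w \<in> A \<Longrightarrow> u w \<le> u m"
    using continuous_attains_sup[OF \<open>compact A\<close> _ contu] \<open>z \<in> A\<close> by blast
  have "u m > B" using m(2)[OF \<open>z \<in> A\<close>] \<open>\<not> u z \<le> B\<close> by simp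
  define S where "S = {w \<in> A. u w = u m}"
  have "closed S" unfolding S_def
    using continuous_closed_preimage_constant[OF contu \<open>closed A\<close>, of "u m"] by simp
  moreover have "S \<subseteq> A" by (auto simp: S_def)
  ultimately have "compact S"
    using \<open>bounded A\<close> bounded_subset by (simp add: compact_eq_bounded_closed) blast
  have "m \<in> S" using m by (simp add: S_def)
  obtain s where s: "s \<in> S" "\<And>w. w \<in> S \<Longrightarrow> norm w \<le> norm s"
    using continuous_attains_sup[OF \<open>compact S\<close>, of norm] \<open>m \<in> S\<close> continuous_on_norm_id by blast
  \<comment> \<open>The maximum exceeds \<open>B\<close>, so it is not attained on either boundary
    circle.\<close>
  have "norm s \<noteq> r" "norm s \<noteq> R" using bd[of s] s(1) \<open>u m > B\<close> by (auto simp: S_def)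
  then have sr: "r < norm s" "norm s < R" using s(1) by (auto simp: S_def A_def)
  define d where "d = min (norm s - r) (R - norm s)"
  have "d > 0" using sr by (simp add: d_def)
  have dA: "ball s d \<subseteq> A"
  proof
    fix w assume "w \<in> ball s d"
    then have "norm (s - w) < norm s - r" "norm (s - w) < R - norm s"
      by (auto simp: d_def dist_norm)
    then show "w \<in> A"
      using norm_triangle_ineq2[of s w] norm_triangle_ineq3[of s w] by (auto simp: A_def)
  qed
  obtain \<Psi> where \<Psi>: "\<And>w. w \<in> ball s d \<Longrightarrow> (\<Psi> has_field_derivative \<phi> w) (at w)"
    and u: "\<And>w. w \<in> ball s d \<Longrightarrow> u w = Re (\<Psi> w)"
    using holo_gradient_on_ball_primitive[OF holo_gradient_on_subset[OF g] \<open>d > 0\<close>, of s] dA A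
    by (auto simp: A_def)
  have "\<Psi> holomorphic_on ball s d" unfolding holomorphic_on_open[OF open_ball] using \<Psi> by blast
  then have hol: "(\<lambda>w. exp (\<Psi> w)) holomorphic_on ball s d" by (intro holomorphic_intros)
  have "(\<lambda>w. exp (\<Psi> w)) constant_on ball s d"
  proof (rule maximum_modulus_principle[OF hol _ _ _ subset_refl])
    show "s \<in> ball s d" using \<open>d > 0\<close> by simp
    fix w assume w: "w \<in> ball s d"
    have "u w \<le> u s" using m(2) s(1) w dA by (auto simp: S_def)
    then show "norm (exp (\<Psi> w)) \<le> norm (exp (\<Psi> s))"
      using u[OF w] u[of s] \<open>d > 0\<close> by (simp add: norm_exp_eq_Re)
  qed auto
  then obtain c where c: "\<And>w. w \<in> ball s d \<Longrightarrow> exp (\<Psi> w) = c" by (auto simp: constant_on_def)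
  have const: "u w = u s" if "w \<in> ball s d" for w
  proof -
    have "exp (Re (\<Psi> w)) = exp (Re (\<Psi> s))"
      using c[OF that] c[of s] \<open>d > 0\<close> by (simp flip: norm_exp_eq_Re)
    then show ?thesis using u[OF that] u[of s] \<open>d > 0\<close> by simp
  qed
  \<comment> \<open>A step from \<open>s\<close> radially outwards, by less than \<open>d\<close>.
    If \<open>s = 0\<close>, possible when \<open>r\<close> is negative, \<open>sgn s\<close>
    vanishes and direction 1 is taken instead.\<close>
  define t where "t = s + of_real (d / 2) * (if s = 0 then 1 else sgn s)"
  have t: "t \<in> ball s d" using \<open>d > 0\<close> by (simp add: t_def dist_norm norm_mult norm_sgn)
  have "norm t > norm s"
  proof (cases "s = 0")
    case False
    have "t = of_real (1 + d / (2 * norm s)) * s"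
      using False by (simp add: t_def sgn_eq field_simps)
    then have "norm t = \<bar>1 + d / (2 * norm s)\<bar> * norm s" by (simp only: norm_mult norm_of_real)
    moreover have "\<bar>1 + d / (2 * norm s)\<bar> * norm s = norm s + d / 2"
      using False \<open>d > 0\<close> by (simp add: abs_of_pos add_pos_pos field_simps)
    ultimately show ?thesis using \<open>d > 0\<close> by simp
  qed (use \<open>d > 0\<close> in \<open>simp add: t_def\<close>)
  moreover have "t \<in> S" using const[OF t] t dA s(1) by (auto simp: S_def)
  ultimately show False using s(2) by force
qed

text \<open>The gradient estimate shows that \<open>z * \<phi> j z\<close> tends to 0, so
  \<open>\<phi> j\<close> extends holomorphically by Riemann's theorem. The real part of a primitive
  of the extension differs from the component of \<open>f\<close> by a constant, also at 0 by
  continuity.\<close>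

lemma removable_singularity_gradient:
  fixes f :: "complex \<Rightarrow> real ^ 'n"
  assumes g: "\<And>j. holo_gradient_on (unit_disc - {0}) (\<lambda>w. f w $ j) (\<phi> j)"
    and lim: "(f \<longlongrightarrow> p) (at 0)"
  obtains \<psi> where "\<And>j. holo_gradient_on unit_disc (\<lambda>w. (f (0 := p)) w $ j) (\<psi> j)"
    and "\<And>j w. w \<in> unit_disc - {0} \<Longrightarrow> \<psi> j w = \<phi> j w"
proof -
  have "\<exists>\<psi>. holo_gradient_on unit_disc (\<lambda>w. (f (0 := p)) w $ j) \<psi> \<and> (\<forall>w\<in>unit_disc - {0}. \<psi> w = \<phi> j w)" for j
  proof -
    let ?u = "\<lambda>w. f w $ j"
    have limj: "((\<lambda>w. f w $ j) \<longlongrightarrow> p $ j) (at 0)" using lim by (rule tendsto_vec_nth)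
    have "((\<lambda>z. (z - 0) * \<phi> j z) \<longlongrightarrow> 0) (at 0)"
    proof (rule tendstoI)
      fix e :: real assume "e > 0"
      \<comment> \<open>With this \<open>B\<close> the gradient estimate on
        \<open>ball z (norm z)\<close> bounds \<open>norm z * norm (\<phi> j z)\<close> by
        \<open>e / 4\<close>.\<close>
      define B where "B = e / (8 * (exp 1)\<^sup>2)"
      have "B > 0" using \<open>e > 0\<close> by (simp add: B_def)
      then obtain d where "d > 0" and d: "\<And>w. w \<noteq> 0 \<Longrightarrow> norm w < d \<Longrightarrow> \<bar>f w $ j - p $ j\<bar> < B"
        using tendstoD[OF limj \<open>B > 0\<close>] by (auto simp: eventually_at dist_real_def)
      \<comment> \<open>The ball around \<open>z\<close> of radius \<open>norm z\<close> avoids 0,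
        and its points have modulus below \<open>2 * norm z\<close>; this explains the half.\<close>
      have "dist ((z - 0) * \<phi> j z) 0 < e" if z: "z \<noteq> 0" "norm z < min d 1 / 2" for z
      proof -
        have in_ball: "w \<noteq> 0 \<and> norm w < min d 1" if "w \<in> ball z (norm z)" for w
        proof -
          have "norm (z - w) < norm z" using that by (simp add: dist_norm)
          moreover have "norm w \<le> norm z + norm (z - w)"
            using norm_triangle_ineq2[of w z] by (simp add: norm_minus_commute)
          ultimately show ?thesis using z by auto
        qed
        have sub: "ball z (norm z) \<subseteq> unit_disc - {0}" using in_ball by (auto simp: dist_norm)
        have "norm (\<phi> j z) \<le> 2 * (exp 1)\<^sup>2 * B / norm z"
        proof (rule gradient_estimate[OF holo_gradient_on_diff_const[OF holo_gradient_on_subset[OF g sub]] _ \<open>B > 0\<close>])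
          show "\<bar>f w $ j - p $ j\<bar> \<le> B" if "w \<in> ball z (norm z)" for w
            using d[of w] in_ball[OF that] by simp
        qed (use z in simp)
        then have "norm z * norm (\<phi> j z) \<le> 2 * (exp 1)\<^sup>2 * B" using z by (simp add: field_simps)
        also have "\<dots> < e" using \<open>e > 0\<close> by (simp add: B_def)
        finally show ?thesis by (simp add: norm_mult)
      qed
      then show "\<forall>\<^sub>F z in at 0. dist ((z - 0) * \<phi> j z) 0 < e"
        unfolding eventually_at using \<open>d > 0\<close> by (intro exI[of _ "min d 1 / 2"]) auto
    qed
    moreover have "\<phi> j holomorphic_on unit_disc - {0}" using g by (simp add: holo_gradient_on_def)
    ultimately obtain \<psi> where \<psi>: "\<psi> holomorphic_on unit_disc" "\<forall>w\<in>unit_disc - {0}. \<psi> w = \<phi> j w"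
      using holomorphic_on_extend_lim[of "\<phi> j" unit_disc 0] by auto
    obtain \<Psi> where \<Psi>: "\<And>w. w \<in> unit_disc \<Longrightarrow> (\<Psi> has_field_derivative \<psi> w) (at w)"
    proof (rule holomorphic_convex_primitive'[OF convex_ball open_ball \<psi>(1)])
    qed (use that at_within_open[OF _ open_ball] in fastforce)
    then have hol\<Psi>: "\<Psi> holomorphic_on unit_disc" unfolding holomorphic_on_open[OF open_ball] by blast
    have F: "continuous_on unit_disc (\<lambda>w. (f (0 := p)) w $ j - Re (\<Psi> w))"
    proof -
      have "isCont (\<lambda>w. (f (0 := p)) w $ j) w" if w: "w \<in> unit_disc" for w
      proof (cases "w = 0")
        case True
        have "((\<lambda>w. (f (0 := p)) w $ j) \<longlongrightarrow> p $ j) (at 0)"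
          by (rule Lim_transform_eventually[OF limj]) (auto simp: eventually_at intro: exI[of _ 1])
        then show ?thesis using True by (simp add: isCont_def)
      next
        case False
        then have "(?u has_derivative (\<lambda>v. Re (\<phi> j w * v))) (at w)"
          using g w by (simp add: holo_gradient_on_def)
        then have "((\<lambda>w. (f (0 := p)) w $ j) has_derivative (\<lambda>v. Re (\<phi> j w * v))) (at w)"
          by (rule has_derivative_transform_within_open[of _ _ _ _ "- {0}"]) (use False in auto)
        then show ?thesis by (rule has_derivative_continuous)
      qed
      then show ?thesis
        using hol\<Psi> by (intro continuous_intros continuous_at_imp_continuous_on holomorphic_on_imp_continuous_on) auto
    qed
    have "((\<lambda>w. (f (0 := p)) w $ j - Re (\<Psi> w)) has_derivative (\<lambda>h. 0)) (at w within unit_disc)"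
      if w: "w \<in> unit_disc - {0}" for w
    proof -
      have "((\<lambda>w. Re (\<Psi> w)) has_derivative (\<lambda>v. Re (\<phi> j w * v))) (at w)"
        using has_derivative_Re[OF \<Psi>[of w]] \<psi>(2) w by simp
      moreover have "(?u has_derivative (\<lambda>v. Re (\<phi> j w * v))) (at w)"
        using g w by (simp add: holo_gradient_on_def)
      ultimately have "((\<lambda>w. ?u w - Re (\<Psi> w)) has_derivative (\<lambda>v. Re (\<phi> j w * v) - Re (\<phi> j w * v))) (at w)"
        by (rule has_derivative_diff[rotated])
      then have "((\<lambda>w. (f (0 := p)) w $ j - Re (\<Psi> w)) has_derivative (\<lambda>v. Re (\<phi> j w * v) - Re (\<phi> j w * v))) (at w)"
        by (rule has_derivative_transform_within_open[of _ _ _ _ "- {0}"]) (use w in auto)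
      then show ?thesis by (simp add: has_derivative_at_withinI)
    qed
    \<comment> \<open>A continuous function on a connected open set whose derivative vanishes off a
      finite set is constant; here that set is \<open>{0}\<close>.\<close>
    then have "(\<lambda>w. (f (0 := p)) w $ j - Re (\<Psi> w)) constant_on unit_disc"
      by (intro has_derivative_zero_connected_constant_on[of _ "{0}"] F) auto
    then obtain c where c: "\<And>w. w \<in> unit_disc \<Longrightarrow> (f (0 := p)) w $ j - Re (\<Psi> w) = c"
      by (auto simp: constant_on_def)
    have "holo_gradient_on unit_disc (\<lambda>w. Re (\<Psi> w)) \<psi>"
      unfolding holo_gradient_on_def by (intro conjI ballI \<psi>(1) has_derivative_Re \<Psi>)
    then have "holo_gradient_on unit_disc (\<lambda>w. Re (\<Psi> w) - (- c)) \<psi>"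
      by (rule holo_gradient_on_diff_const)
    then have "holo_gradient_on unit_disc (\<lambda>w. (f (0 := p)) w $ j) \<psi>"
      by (rule holo_gradient_on_cong[OF open_ball]) (use c in \<open>simp add: algebra_simps\<close>)
    then show ?thesis using \<psi>(2) by blast
  qed
  then obtain \<psi> where "\<forall>j. holo_gradient_on unit_disc (\<lambda>w. (f (0 := p)) w $ j) (\<psi> j) \<and> (\<forall>w\<in>unit_disc - {0}. \<psi> j w = \<phi> j w)"
    using choice[of "\<lambda>j \<psi>. holo_gradient_on unit_disc (\<lambda>w. (f (0 := p)) w $ j) \<psi> \<and> (\<forall>w\<in>unit_disc - {0}. \<psi> w = \<phi> j w)"]
    by blast
  then show ?thesis using that by blast
qed

section \<open>Behaviour at the puncture and extension\<close>

text \<open>This is where hyperbolicity enters: circles whose images stay large would join points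
  near \<open>p\<close> to points near another point \<open>q\<close> at arbitrarily small
  cost.\<close>

lemma circle_images_converge:
  fixes f :: "complex \<Rightarrow> real ^ 'n"
  assumes card: "CARD('n) \<ge> 2" and "open \<Omega>" and hyp: "hyperbolic \<Omega>"
    and f: "f \<in> CH (unit_disc - {0}) \<Omega>" and z: "\<And>k. z k \<in> unit_disc - {0}"
    and z0: "z \<longlonglongrightarrow> 0" and "p \<in> \<Omega>" and fz: "(\<lambda>k. f (z k)) \<longlonglongrightarrow> p" and "e > 0"
  shows "\<forall>\<^sub>F k in sequentially. \<forall>w. norm w = norm (z k) \<longrightarrow> dist (f w) p < e"
proof (rule ccontr)
  assume contra: "\<not> ?thesis"
  obtain \<delta> where "\<delta> > 0" and \<delta>: "ball p \<delta> \<subseteq> \<Omega>"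
    using \<open>open \<Omega>\<close> \<open>p \<in> \<Omega>\<close> open_contains_ball by blast
  \<comment> \<open>A circle image leaving the ball of radius \<open>e\<close> must cross the sphere
    of radius \<open>\<epsilon>\<close>, as \<open>\<epsilon> \<le> e\<close>; and
    \<open>2 * \<epsilon> \<le> \<delta>\<close> leaves room in \<open>\<Omega>\<close> for balls of
    radius \<open>\<epsilon>\<close> around points of \<open>cball p \<epsilon>\<close>.\<close>
  define \<epsilon> where "\<epsilon> = min e (\<delta> / 2)"
  have "\<epsilon> > 0" "\<epsilon> \<le> e" "2 * \<epsilon> \<le> \<delta>" using \<open>e > 0\<close> \<open>\<delta> > 0\<close> by (auto simp: \<epsilon>_def)
  have balls: "ball x \<epsilon> \<subseteq> \<Omega>" if "x \<in> cball p \<epsilon>" for x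
  proof
    fix y assume "y \<in> ball x \<epsilon>"
    then have "y \<in> ball p \<delta>"
      using that dist_triangle[of p y x] \<open>2 * \<epsilon> \<le> \<delta>\<close> by simp
    then show "y \<in> \<Omega>" using \<delta> by blast
  qed
  have contf: "continuous_on (unit_disc - {0}) f"
  proof (intro continuous_at_imp_continuous_on ballI)
    fix w assume "w \<in> unit_disc - {0::complex}"
    then obtain f' where "(f has_derivative f') (at w)" using CH_has_derivative[OF f] by blast
    then show "isCont f w" by (rule has_derivative_continuous)
  qed
  define S where "S = {k. \<exists>w. norm w = norm (z k) \<and> dist (f w) p = \<epsilon>}"
  have cross: "k \<in> S"
    if "dist (f (z k)) p < \<epsilon>" "norm w = norm (z k)" "\<not> dist (f w) p < e" for k w
  proof -
    let ?C = "sphere 0 (norm (z k)) :: complex set"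
    have "?C \<subseteq> unit_disc - {0}" using z[of k] by auto
    then have "continuous_on ?C (\<lambda>w. dist (f w) p)"
      by (intro continuous_intros continuous_on_subset[OF contf])
    \<comment> \<open>Intermediate values on the connected circle: the distance to \<open>p\<close>
      is below \<open>\<epsilon>\<close> at \<open>z k\<close> and at least
      \<open>\<epsilon>\<close> at \<open>w\<close>.\<close>
    then have "connected ((\<lambda>w. dist (f w) p) ` ?C)"
      by (intro connected_continuous_image connected_sphere) auto
    moreover have "dist (f (z k)) p \<in> (\<lambda>w. dist (f w) p) ` ?C" "dist (f w) p \<in> (\<lambda>w. dist (f w) p) ` ?C"
      using that by auto
    moreover have "dist (f (z k)) p \<le> \<epsilon>" "\<epsilon> \<le> dist (f w) p" using that \<open>\<epsilon> \<le> e\<close> by auto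
    ultimately have "\<epsilon> \<in> (\<lambda>w. dist (f w) p) ` ?C" by (rule connectedD_interval)
    then show ?thesis by (auto simp: S_def)
  qed
  have "\<exists>\<^sub>F k in sequentially. \<not> (\<forall>w. norm w = norm (z k) \<longrightarrow> dist (f w) p < e)"
    using contra by (simp add: not_eventually)
  moreover have "\<forall>\<^sub>F k in sequentially. \<not> (\<forall>w. norm w = norm (z k) \<longrightarrow> dist (f w) p < e) \<longrightarrow> k \<in> S"
    using tendstoD[OF fz \<open>\<epsilon> > 0\<close>] by eventually_elim (auto intro: cross)
  ultimately have "\<exists>\<^sub>F k in sequentially. k \<in> S" by (rule frequently_rev_mp)
  then have "infinite S" by (simp add: frequently_cofinite flip: cofinite_eq_sequentially)
  \<comment> \<open>Two extractions: \<open>s\<close> enumerates the crossing circles, and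
    \<open>r\<close> makes the crossing points converge, by compactness of the sphere.\<close>
  then obtain s :: "nat \<Rightarrow> nat" where s: "strict_mono s" "\<And>n. s n \<in> S"
    using infinite_enumerate by blast
  then have "\<forall>n. \<exists>w. norm w = norm (z (s n)) \<and> dist (f w) p = \<epsilon>" by (simp add: S_def)
  from choice[OF this] obtain w where w: "\<And>n. norm (w n) = norm (z (s n))" "\<And>n. dist (f (w n)) p = \<epsilon>"
    by blast
  have "\<forall>n. f (w n) \<in> sphere p \<epsilon>" using w(2) by (simp add: dist_commute)
  then obtain q r where q: "q \<in> sphere p \<epsilon>" and "strict_mono r" and "((\<lambda>n. f (w n)) \<circ> r) \<longlonglongrightarrow> q"
    by (rule seq_compactE[OF compact_imp_seq_compact[OF compact_sphere[of p \<epsilon>]]])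
  then have fw: "(\<lambda>n. f (w (r n))) \<longlonglongrightarrow> q" by (simp add: o_def)
  define z' where "z' n = z (s (r n))" for n
  have sr: "strict_mono (s \<circ> r)" using s(1) \<open>strict_mono r\<close> by (rule strict_mono_o)
  have z': "z' \<longlonglongrightarrow> 0" "(\<lambda>n. f (z' n)) \<longlonglongrightarrow> p"
    using LIMSEQ_subseq_LIMSEQ[OF z0 sr] LIMSEQ_subseq_LIMSEQ[OF fz sr]
    by (simp_all add: z'_def[abs_def] o_def)
  have "minimal_pseudodistance \<Omega> p q \<le> ennreal M" if "M > 0" for M
  proof -
    have "M * \<epsilon> / 3 > 0" using that \<open>\<epsilon> > 0\<close> by simp
    \<comment> \<open>For large \<open>n\<close> both segments are short enough for
      \<open>M\<close>, and \<open>z' n\<close> is so close to 0 that the logarithm dominates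
      \<open>3 * pi / M\<close>.\<close>
    have "\<forall>\<^sub>F n in sequentially. dist (f (z' n)) p < M * \<epsilon> / 3 \<and> dist (f (z' n)) p < \<epsilon> \<and>
        dist (f (w (r n))) q < M * \<epsilon> / 3 \<and> dist (z' n) 0 < exp (- (3 * pi / M))"
      by (intro eventually_conj tendstoD z' fw \<open>M * \<epsilon> / 3 > 0\<close> \<open>\<epsilon> > 0\<close>) simp
    then obtain n where n: "dist (f (z' n)) p < M * \<epsilon> / 3" "dist (f (z' n)) p < \<epsilon>"
        "dist (f (w (r n))) q < M * \<epsilon> / 3" "norm (z' n) < exp (- (3 * pi / M))"
      by (auto dest!: eventually_happens)
    show ?thesis
    proof (rule pseudodistance_le[OF card f _ _ \<open>\<epsilon> > 0\<close> balls])
      show zn: "z' n \<in> unit_disc - {0}" using z by (simp add: z'_def)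
      show "norm (w (r n)) = norm (z' n)" by (simp add: w z'_def)
      show "f (z' n) \<in> cball p \<epsilon>" "f (w (r n)) \<in> cball p \<epsilon>" "q \<in> cball p \<epsilon>"
        using n w(2) q by (auto simp: dist_commute)
      show "3 * norm (f (z' n) - p) \<le> M * \<epsilon>" "3 * norm (q - f (w (r n))) \<le> M * \<epsilon>"
        using n by (auto simp: dist_norm norm_minus_commute)
      have "ln (norm (z' n)) < ln (exp (- (3 * pi / M)))"
        using n(4) zn by (subst ln_less_cancel_iff) auto
      then show "3 * pi \<le> M * - ln (norm (z' n))" using that by (simp add: field_simps)
    qed (use that in auto)
  qed
  then have "minimal_pseudodistance \<Omega> p q \<le> 0 + ennreal M" if "M > 0" for M
    using that by simp
  then have "minimal_pseudodistance \<Omega> p q \<le> 0"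
    by (rule ennreal_le_epsilon)
  moreover have "q \<in> \<Omega>"
  proof -
    have "q \<in> cball p \<epsilon>" using q by simp
    then show ?thesis using balls[of q] centre_in_ball[of q \<epsilon>] \<open>\<epsilon> > 0\<close> by blast
  qed
  moreover have "p \<noteq> q" using q \<open>\<epsilon> > 0\<close> by auto
  ultimately show False using hyp \<open>p \<in> \<Omega>\<close> unfolding hyperbolic_def by (simp add: not_le[symmetric])
qed

text \<open>Each component of \<open>f - p\<close> is small on the chosen circles, hence on the
  annuli between them, and these annuli fill a punctured neighbourhood of 0.\<close>

lemma CH_punctured_tendsto:
  fixes f :: "complex \<Rightarrow> real ^ 'n"
  assumes f: "f \<in> CH (unit_disc - {0}) \<Omega>" and z: "\<And>k. z k \<in> unit_disc - {0}" and z0: "z \<longlonglongrightarrow> 0"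
    and circ: "\<And>e. e > 0 \<Longrightarrow> \<forall>\<^sub>F k in sequentially. \<forall>w. norm w = norm (z k) \<longrightarrow> dist (f w) p < e"
  shows "(f \<longlongrightarrow> p) (at 0)"
proof (rule vec_tendstoI, rule tendstoI)
  fix j and e :: real assume "e > 0"
  obtain \<phi> where g: "\<And>j. holo_gradient_on (unit_disc - {0}) (\<lambda>w. f w $ j) (\<phi> j)"
    using f by (auto simp: CH_iff open_delete)
  \<comment> \<open>Half of \<open>e\<close> is used because the maximum principle yields only a
    weak inequality.\<close>
  obtain K where K: "\<And>k w. k \<ge> K \<Longrightarrow> norm w = norm (z k) \<Longrightarrow> dist (f w) p < e / 2"
    using circ[of "e / 2"] \<open>e > 0\<close> by (auto simp: eventually_sequentially)
  have bd: "\<bar>f w $ j - p $ j\<bar> \<le> e / 2" if "k \<ge> K" "norm w = norm (z k)" for k w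
    using K[OF that] component_le_norm_cart[of "f w - p" j] by (simp add: dist_norm)
  have "\<bar>f w $ j - p $ j\<bar> \<le> e / 2" if w: "w \<noteq> 0" "norm w < norm (z K)" for w
  proof -
    \<comment> \<open>The outer circle is fixed by \<open>K\<close>; the inner one is chosen after
      \<open>w\<close>, close enough to 0 to enclose \<open>w\<close> in an annulus.\<close>
    have "\<forall>\<^sub>F k in sequentially. dist (z k) 0 < norm w \<and> k \<ge> K"
      using tendstoD[OF z0, of "norm w"] w eventually_ge_at_top[of K] by (simp add: eventually_conj)
    then obtain k where k: "norm (z k) < norm w" "k \<ge> K" by (auto dest!: eventually_happens)
    have A: "{w. norm (z k) \<le> norm w \<and> norm w \<le> norm (z K)} \<subseteq> unit_disc - {0}"
      using z[of k] z[of K] by auto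
    have g': "holo_gradient_on (unit_disc - {0}) (\<lambda>w. f w $ j - p $ j) (\<phi> j)"
      by (rule holo_gradient_on_diff_const[OF g])
    have bd': "\<bar>f x $ j - p $ j\<bar> \<le> e / 2" if "norm x = norm (z k) \<or> norm x = norm (z K)" for x
      using that bd[of k x] bd[of K x] k(2) by auto
    have "f w $ j - p $ j \<le> e / 2"
      by (rule annulus_maximum_principle[OF g' A _ less_imp_le[OF k(1)] less_imp_le[OF w(2)]])
        (rule abs_le_D1[OF bd'])
    \<comment> \<open>The lower bound comes from the maximum principle for the negated
      component.\<close>
    moreover have "- (f w $ j - p $ j) \<le> e / 2"
      by (rule annulus_maximum_principle[OF holo_gradient_on_uminus[OF g'] A _ less_imp_le[OF k(1)] less_imp_le[OF w(2)]])
        (rule abs_le_D2[OF bd'])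
    ultimately show ?thesis by linarith
  qed
  moreover have "norm (z K) > 0" using z[of K] by simp
  ultimately show "\<forall>\<^sub>F w in at 0. dist (f w $ j) (p $ j) < e"
    unfolding eventually_at using \<open>e > 0\<close>
    by (intro exI[of _ "norm (z K)"]) (force simp: dist_real_def)
qed

text \<open>Harmonicity across 0 comes from the extended gradients \<open>\<psi> j\<close>;
  conformality at 0 follows because their sum of squares is continuous and vanishes
  elsewhere.\<close>

lemma CH_punctured_extend:
  fixes f :: "complex \<Rightarrow> real ^ 'n"
  assumes f: "f \<in> CH (unit_disc - {0}) \<Omega>" and "p \<in> \<Omega>" and lim: "(f \<longlongrightarrow> p) (at 0)"
  shows "f (0 := p) \<in> CH unit_disc \<Omega>"
proof -
  have op: "open (unit_disc - {0::complex})" by (simp add: open_delete)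
  obtain \<phi> where g: "\<And>j. holo_gradient_on (unit_disc - {0}) (\<lambda>w. f w $ j) (\<phi> j)"
    and sq: "\<And>w. w \<in> unit_disc - {0} \<Longrightarrow> (\<Sum>j\<in>UNIV. (\<phi> j w)\<^sup>2) = 0"
    and im: "f ` (unit_disc - {0}) \<subseteq> \<Omega>"
    using f unfolding CH_iff[OF op] by blast
  obtain \<psi> where \<psi>: "\<And>j. holo_gradient_on unit_disc (\<lambda>w. (f (0 := p)) w $ j) (\<psi> j)"
    and eq: "\<And>j w. w \<in> unit_disc - {0} \<Longrightarrow> \<psi> j w = \<phi> j w"
    using removable_singularity_gradient[OF g lim] by blast
  define Q where "Q w = (\<Sum>j\<in>UNIV. (\<psi> j w)\<^sup>2)" for w
  have Q: "Q w = 0" if "w \<in> unit_disc - {0}" for w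
    using sq[OF that] eq[OF that] by (simp add: Q_def)
  have "continuous_on unit_disc Q"
    unfolding Q_def using \<psi> by (intro continuous_intros) (auto simp: holo_gradient_on_def holomorphic_on_imp_continuous_on)
  then have "(Q \<longlongrightarrow> Q 0) (at 0)" by (simp add: continuous_on_eq_continuous_at isCont_def)
  moreover have "(Q \<longlongrightarrow> 0) (at 0)"
    by (rule tendsto_eventually) (use Q in \<open>auto simp: eventually_at intro!: exI[of _ 1]\<close>)
  ultimately have "Q 0 = 0" by (rule LIM_unique)
  then have "Q w = 0" if "w \<in> unit_disc" for w using Q that by (cases "w = 0") auto
  then show ?thesis unfolding CH_iff[OF open_ball]
    using \<psi> im \<open>p \<in> \<Omega>\<close> by (intro conjI exI[of _ \<psi>]) (auto simp: Q_def)
qed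

theorem theorem11p1:
  fixes \<Omega> :: "(real ^ 'n::finite) set" and f :: "complex \<Rightarrow> real ^ 'n" and z :: "nat \<Rightarrow> complex"
  assumes "CARD('n) \<ge> 3"
    and "domain \<Omega>" and "hyperbolic \<Omega>"
    and "f \<in> CH (unit_disc - {0}) \<Omega>"
    and "\<And>k. z k \<in> unit_disc - {0}" and "z \<longlonglongrightarrow> 0"
    and "\<exists>p\<in>\<Omega>. (\<lambda>k. f (z k)) \<longlonglongrightarrow> p"
  shows "\<exists>F \<in> CH unit_disc \<Omega>. \<forall>w \<in> unit_disc - {0}. F w = f w"
proof -
  obtain p where p: "p \<in> \<Omega>" "(\<lambda>k. f (z k)) \<longlonglongrightarrow> p" using assms(7) by blast
  have "CARD('n) \<ge> 2" "open \<Omega>" using assms(1,2) by (auto simp: domain_def)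
  from circle_images_converge[OF this assms(3-6) p]
  have "(f \<longlongrightarrow> p) (at 0)" by (rule CH_punctured_tendsto[OF assms(4-6)])
  then have "f (0 := p) \<in> CH unit_disc \<Omega>" by (rule CH_punctured_extend[OF assms(4) p(1)])
  then show ?thesis by (intro bexI[of _ "f (0 := p)"]) auto
qed

end
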